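(* Let $g_1,g_2\in\mathbb P_{\mathbb K}V$ be distinct nonorthogonal points such that the geodesic $G\wr g_1,g_2\wr$ is noneuclidean, and let $L$ denote its projective line. (i) A point $x\in L$ belongs to $G\wr g_1,g_2\wr$ if and only if $$b(x,g_1,g_2):=\langle x,g_1\rangle\langle g_1,g_2\rangle\langle g_2,x\rangle-\langle x,g_2\rangle\langle g_2,g_1\rangle\langle g_1,x\rangle=0.$$ (ii) Let $g\in G\wr g_1,g_2\wr$ and let $\varphi\in\mathrm{Lin}_{\mathbb K}(g,V)$ be such that $t_\varphi\in T_gL$. Then $t_\varphi\in T_gG\wr g_1,g_2\wr$ if and only if $$\langle\varphi g,g_1\rangle\langle g_1,g_2\rangle\langle g_2,g\rangle+\langle g,g_1\rangle\langle g_1,g_2\rangle\langle g_2,\varphi g\rangle-\langle\varphi g,g_2\rangle\langle g_2,g_1\rangle\langle g_1,g\rangle-\langle g,g_2\rangle\langle g_2,g_1\rangle\langle g_1,\varphi g\rangle=0.$$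
   Context: $\mathbb K$ is $\mathbb R$, $\mathbb C$ or $\mathbb H$ (quaternions). $V$ is a finite-dimensional right $\mathbb K$-vector space with a hermitian form $\langle-,-\rangle$: it takes values in $\mathbb K$, is biadditive, and satisfies $\langle v_1k,v_2\rangle=\overline k\langle v_1,v_2\rangle$, $\langle v_1,v_2k\rangle=\langle v_1,v_2\rangle k$, $\langle v_1,v_2\rangle=\overline{\langle v_2,v_1\rangle}$. A point of $\mathbb P_{\mathbb K}V$, a representative in $V$, and the corresponding one-dimensional subspace are denoted by the same letter; the equations in the claim do not depend on the choice of representatives. Points $p,q$ are orthogonal if $\langle p,q\rangle=0$. A geodesic is a circle $\mathbb P_{\mathbb K}W\subset\mathbb P_{\mathbb K}V$ (the image of $W\setminus\{0\}$), where $W\subset V$ is a 2-dimensional real subspace on which the hermitian form is real-valued and not identically zero; its projective line is $\mathbb P_{\mathbb K}(W\mathbb K)$, the projectivization of the 2-dimensional $\mathbb K$-subspace $W\mathbb K$. The geodesic is euclidean if the form on $W\mathbb K$ is (nonnull and) degenerate, and noneuclidean otherwise. Two distinct nonorthogonal points $g_1,g_2$ lie on a unique geodesic, denoted $G\wr g_1,g_2\wr$. For $\varphi\in\mathrm{Lin}_{\mathbb K}(g,V)$, $t_\varphi\in T_g\mathbb P_{\mathbb K}V$ is the tangent vector $t_\varphi f:=\frac{d}{d\varepsilon}|_{\varepsilon=0}\hat f\big((1+\varepsilon\varphi)g\big)$, where $\hat f$ is the lift of the smooth function $f$ to $V\setminus\{0\}$. *)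

theory Defs
  imports "HOL-Analysis.Analysis"
begin

section \<open>The scalars: real numbers, complex numbers, quaternions\<close>

text \<open>
  The axioms force \<open>kconj x = (norm x)\<^sup>2 * inverse x\<close>, and additivity applied to \<open>1 + x\<close> shows that
  \<open>x + kconj x\<close> is real, so every element satisfies a real quadratic equation. By the theorem of
  Frobenius the models are, up to isomorphism, exactly the reals, the complex numbers and the
  quaternions, each with its standard conjugation and absolute value; these three are
  instantiated below.
\<close>

class conj_div_algebra = real_normed_div_algebra +
  fixes kconj :: "'a \<Rightarrow> 'a"
  assumes kconj_add: "kconj (x + y) = kconj x + kconj y"
    and kconj_mult: "kconj (x * y) = kconj y * kconj x"
    and kconj_kconj: "kconj (kconj x) = x"
    and mult_kconj: "x * kconj x = (norm x)\<^sup>2 *\<^sub>R 1"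

instantiation real :: conj_div_algebra
begin

definition kconj_real :: "real \<Rightarrow> real" where "kconj_real x = x"

instance
  by standard (simp_all add: kconj_real_def power2_eq_square)

end

instantiation complex :: conj_div_algebra
begin

definition kconj_complex :: "complex \<Rightarrow> complex" where "kconj_complex = cnj"

instance
  by standard (simp_all add: kconj_complex_def mult.commute complex_norm_square scaleR_conv_of_real flip: of_real_power)

end

datatype quat = Quat (qRe: real) (qI: real) (qJ: real) (qK: real)

lemma quat_eq_iff:
  "x = y \<longleftrightarrow> qRe x = qRe y \<and> qI x = qI y \<and> qJ x = qJ y \<and> qK x = qK y"
  by (cases x; cases y) simp

instantiation quat :: real_normed_div_algebra
begin

definition "0 = Quat 0 0 0 0"
definition "1 = Quat 1 0 0 0"
definition "x + y = Quat (qRe x + qRe y) (qI x + qI y) (qJ x + qJ y) (qK x + qK y)"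
definition "x - y = Quat (qRe x - qRe y) (qI x - qI y) (qJ x - qJ y) (qK x - qK y)"
definition "- x = Quat (- qRe x) (- qI x) (- qJ x) (- qK x)"
definition "r *\<^sub>R x = Quat (r * qRe x) (r * qI x) (r * qJ x) (r * qK x)"
definition "x * y = Quat
  (qRe x * qRe y - qI x * qI y - qJ x * qJ y - qK x * qK y)
  (qRe x * qI y + qI x * qRe y + qJ x * qK y - qK x * qJ y)
  (qRe x * qJ y - qI x * qK y + qJ x * qRe y + qK x * qI y)
  (qRe x * qK y + qI x * qJ y - qJ x * qI y + qK x * qRe y)"
definition "norm x = sqrt ((qRe x)\<^sup>2 + (qI x)\<^sup>2 + (qJ x)\<^sup>2 + (qK x)\<^sup>2)"
definition "inverse x =
  (let s = inverse ((qRe x)\<^sup>2 + (qI x)\<^sup>2 + (qJ x)\<^sup>2 + (qK x)\<^sup>2)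
   in Quat (s * qRe x) (- s * qI x) (- s * qJ x) (- s * qK x))"
definition "x div y = x * inverse y" for x y :: quat
definition "sgn x = inverse (norm x) *\<^sub>R x" for x :: quat
definition "dist x y = norm (x - y)" for x y :: quat
definition [code del]:
  "(uniformity :: (quat \<times> quat) filter) = (INF e\<in>{0<..}. principal {(x, y). dist x y < e})"
definition [code del]:
  "open (U :: quat set) \<longleftrightarrow> (\<forall>x\<in>U. eventually (\<lambda>(x', y). x' = x \<longrightarrow> y \<in> U) uniformity)"

lemmas quat_ops = zero_quat_def one_quat_def plus_quat_def minus_quat_def uminus_quat_def
  scaleR_quat_def times_quat_def

lemma quat_norm_pos: "x \<noteq> 0 \<Longrightarrow> (qRe x)\<^sup>2 + (qI x)\<^sup>2 + (qJ x)\<^sup>2 + (qK x)\<^sup>2 > 0" for x :: quat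
  by (cases x) (auto simp: zero_quat_def add_pos_nonneg add_nonneg_pos)

lemma quat_norm_prod:
  "norm x = norm ((qRe x, qI x), (qJ x, qK x))" for x :: quat
  by (simp add: norm_quat_def norm_Pair add.assoc)

instance
proof
  fix x y z :: quat and a b :: real
  show "x + y + z = x + (y + z)" "x + y = y + x" "0 + x = x" "- x + x = 0" "x - y = x + - y"
    "(0 :: quat) \<noteq> 1" "1 * x = x" "x * 1 = x"
    by (simp_all add: quat_eq_iff quat_ops)
  show "x * y * z = x * (y * z)" "(x + y) * z = x * z + y * z" "x * (y + z) = x * y + x * z"
    by (simp_all add: quat_eq_iff quat_ops algebra_simps)
  show "a *\<^sub>R (x + y) = a *\<^sub>R x + a *\<^sub>R y" "(a + b) *\<^sub>R x = a *\<^sub>R x + b *\<^sub>R x"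
    "a *\<^sub>R b *\<^sub>R x = (a * b) *\<^sub>R x" "1 *\<^sub>R x = x"
    "a *\<^sub>R x * y = a *\<^sub>R (x * y)" "x * a *\<^sub>R y = a *\<^sub>R (x * y)"
    by (simp_all add: quat_eq_iff quat_ops algebra_simps)
  show "x div y = x * inverse y" by (rule divide_quat_def)
  show "inverse (0 :: quat) = 0"
    by (simp add: inverse_quat_def zero_quat_def)
  let ?s = "\<lambda>x. (qRe x)\<^sup>2 + (qI x)\<^sup>2 + (qJ x)\<^sup>2 + (qK x)\<^sup>2"
  have inv: "Quat (s * qRe x) (- s * qI x) (- s * qJ x) (- s * qK x) * x = Quat (s * ?s x) 0 0 0"
    "x * Quat (s * qRe x) (- s * qI x) (- s * qJ x) (- s * qK x) = Quat (s * ?s x) 0 0 0" for s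
    by (simp_all add: quat_eq_iff quat_ops power2_eq_square algebra_simps)
  show "inverse x * x = 1" "x * inverse x = 1" if "x \<noteq> 0"
    using quat_norm_pos[OF that] inv by (simp_all add: inverse_quat_def Let_def one_quat_def)
  show "sgn x = inverse (norm x) *\<^sub>R x" by (rule sgn_quat_def)
  show "dist x y = norm (x - y)" by (rule dist_quat_def)
  show "(uniformity :: (quat \<times> quat) filter) = (INF e\<in>{0<..}. principal {(x, y). dist x y < e})"
    by (rule uniformity_quat_def)
  show "open U \<longleftrightarrow> (\<forall>x\<in>U. eventually (\<lambda>(x', y). x' = x \<longrightarrow> y \<in> U) uniformity)" for U :: "quat set"
    by (rule open_quat_def)
  show "norm x = 0 \<longleftrightarrow> x = 0"
    by (simp add: quat_norm_prod quat_eq_iff zero_quat_def prod_eq_iff)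
  show "norm (x + y) \<le> norm x + norm y"
    using norm_triangle_ineq[of "((qRe x, qI x), (qJ x, qK x))" "((qRe y, qI y), (qJ y, qK y))"]
    by (simp add: quat_norm_prod plus_quat_def)
  show "norm (a *\<^sub>R x) = \<bar>a\<bar> * norm x"
    using norm_scaleR[of a "((qRe x, qI x), (qJ x, qK x))"]
    by (simp add: quat_norm_prod scaleR_quat_def)
  have "?s (x * y) = ?s x * ?s y"
    by (simp add: times_quat_def power2_eq_square algebra_simps)
  then show "norm (x * y) = norm x * norm y"
    by (simp add: norm_quat_def real_sqrt_mult)
qed

end

instantiation quat :: conj_div_algebra
begin

definition kconj_quat :: "quat \<Rightarrow> quat" where
  "kconj_quat x = Quat (qRe x) (- qI x) (- qJ x) (- qK x)"

instance
proof
  fix x y :: quat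
  show "kconj (x + y) = kconj x + kconj y" "kconj (x * y) = kconj y * kconj x"
    "kconj (kconj x) = x"
    by (simp_all add: kconj_quat_def quat_eq_iff quat_ops algebra_simps)
  show "x * kconj x = (norm x)\<^sup>2 *\<^sub>R 1"
    by (simp add: kconj_quat_def norm_quat_def quat_eq_iff quat_ops power2_eq_square)
qed

end


section \<open>Hermitian spaces and their projectivizations\<close>

text \<open>
  The type class \<open>euclidean_space\<close> makes \<open>V\<close> a nonzero finite-dimensional real vector space with
  its usual topology. Its inner product is unrelated to the hermitian form and to the scalar
  multiplication, and no definition below depends on its choice.
\<close>

locale hermitian_space =
  fixes scale :: "'v::euclidean_space \<Rightarrow> 'k::conj_div_algebra \<Rightarrow> 'v" (infixl "\<star>" 75)
    and form :: "'v \<Rightarrow> 'v \<Rightarrow> 'k" ("\<langle>_, _\<rangle>")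
  assumes scale_add_left: "(v + w) \<star> k = v \<star> k + w \<star> k"
    and scale_add_right: "v \<star> (k + l) = v \<star> k + v \<star> l"
    and scale_mult: "v \<star> (k * l) = v \<star> k \<star> l"
    and scale_of_real: "v \<star> of_real r = r *\<^sub>R v"
    and form_add_left: "\<langle>v + w, u\<rangle> = \<langle>v, u\<rangle> + \<langle>w, u\<rangle>"
    and form_add_right: "\<langle>u, v + w\<rangle> = \<langle>u, v\<rangle> + \<langle>u, w\<rangle>"
    and form_scale_left: "\<langle>v \<star> k, w\<rangle> = kconj k * \<langle>v, w\<rangle>"
    and form_scale_right: "\<langle>v, w \<star> k\<rangle> = \<langle>v, w\<rangle> * k"
    and form_commute: "\<langle>v, w\<rangle> = kconj \<langle>w, v\<rangle>"

context
  fixes scale :: "'v::euclidean_space \<Rightarrow> 'k::conj_div_algebra \<Rightarrow> 'v" (infixl "\<star>" 75)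
    and form :: "'v \<Rightarrow> 'v \<Rightarrow> 'k" ("\<langle>_, _\<rangle>")
begin

definition point :: "'v \<Rightarrow> 'v set" where
  "point v = range (\<lambda>k. v \<star> k)"

definition projectivize :: "'v set \<Rightarrow> 'v set set" where
  "projectivize S = point ` (S - {0})"

definition ksubspace :: "'v set \<Rightarrow> bool" where
  "ksubspace S \<longleftrightarrow> 0 \<in> S \<and> (\<forall>u\<in>S. \<forall>v\<in>S. u + v \<in> S) \<and> (\<forall>u\<in>S. \<forall>k. u \<star> k \<in> S)"

definition kspan :: "'v set \<Rightarrow> 'v set" where
  "kspan S = ksubspace hull S"

definition klinear_on :: "'v set \<Rightarrow> ('v \<Rightarrow> 'v) \<Rightarrow> bool" where
  "klinear_on S \<phi> \<longleftrightarrow>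
    (\<forall>u\<in>S. \<forall>v\<in>S. \<phi> (u + v) = \<phi> u + \<phi> v) \<and> (\<forall>u\<in>S. \<forall>k. \<phi> (u \<star> k) = \<phi> u \<star> k)"


subsection \<open>Geodesics\<close>

text \<open>In \<open>geodesic_plane\<close>, \<open>subspace\<close> and \<open>dim\<close> refer to the real vector space structure.\<close>

definition geodesic_plane :: "'v set \<Rightarrow> bool" where
  "geodesic_plane W \<longleftrightarrow> subspace W \<and> dim W = 2 \<and>
    (\<forall>u\<in>W. \<forall>v\<in>W. \<langle>u, v\<rangle> \<in> \<real>) \<and> (\<exists>u\<in>W. \<exists>v\<in>W. \<langle>u, v\<rangle> \<noteq> 0)"

definition geodesic :: "'v set set \<Rightarrow> bool" where
  "geodesic G \<longleftrightarrow> (\<exists>W. geodesic_plane W \<and> G = projectivize W)"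

definition geodesic_line :: "'v set set \<Rightarrow> 'v set set" where
  "geodesic_line G =
    (THE L. \<exists>W. geodesic_plane W \<and> G = projectivize W \<and> L = projectivize (kspan W))"

definition nonnull_on :: "'v set \<Rightarrow> bool" where
  "nonnull_on S \<longleftrightarrow> (\<exists>u\<in>S. \<exists>v\<in>S. \<langle>u, v\<rangle> \<noteq> 0)"

definition degenerate_on :: "'v set \<Rightarrow> bool" where
  "degenerate_on S \<longleftrightarrow> (\<exists>u\<in>S. u \<noteq> 0 \<and> (\<forall>v\<in>S. \<langle>u, v\<rangle> = 0))"

definition euclidean_geodesic :: "'v set set \<Rightarrow> bool" where
  "euclidean_geodesic G \<longleftrightarrow> (\<exists>W. geodesic_plane W \<and> G = projectivize W \<and>
    nonnull_on (kspan W) \<and> degenerate_on (kspan W))"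

definition noneuclidean_geodesic :: "'v set set \<Rightarrow> bool" where
  "noneuclidean_geodesic G \<longleftrightarrow> geodesic G \<and> \<not> euclidean_geodesic G"

definition geodesic_through :: "'v set \<Rightarrow> 'v set \<Rightarrow> 'v set set" where
  "geodesic_through p q = (THE G. geodesic G \<and> p \<in> G \<and> q \<in> G)"

end


section \<open>Tangent vectors\<close>

text \<open>\<open>C\<^sup>k\<close> and smooth maps; the definition is meant for open \<open>S\<close> in a finite-dimensional space.\<close>

primrec Ck_on ::
  "nat \<Rightarrow> 'a::real_normed_vector set \<Rightarrow> ('a \<Rightarrow> 'b::real_normed_vector) \<Rightarrow> bool" where
  "Ck_on 0 S f \<longleftrightarrow> continuous_on S f"
| "Ck_on (Suc n) S f \<longleftrightarrow> (\<forall>x\<in>S. f differentiable (at x)) \<and>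
    (\<forall>v. Ck_on n S (\<lambda>x. frechet_derivative f (at x) v))"

definition smooth_on ::
  "'a::real_normed_vector set \<Rightarrow> ('a \<Rightarrow> 'b::real_normed_vector) \<Rightarrow> bool" where
  "smooth_on S f \<longleftrightarrow> (\<forall>n. Ck_on n S f)"

context
  fixes scale :: "'v::euclidean_space \<Rightarrow> 'k::conj_div_algebra \<Rightarrow> 'v" (infixl "\<star>" 75)
begin

text \<open>
  Real functions on the projective space that are smooth on some neighbourhood \<open>N\<close> of the point
  \<open>p\<close>: the preimage of \<open>N\<close> in \<open>V - {0}\<close> is open and the lift of \<open>f\<close> is smooth on it.
\<close>

definition smooth_functions_at :: "'v set \<Rightarrow> ('v set \<Rightarrow> real) set" where
  "smooth_functions_at p = {f. \<exists>N \<subseteq> projectivize scale UNIV. p \<in> N \<and>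
    open {x. x \<noteq> 0 \<and> point scale x \<in> N} \<and>
    smooth_on {x. x \<noteq> 0 \<and> point scale x \<in> N} (\<lambda>x. f (point scale x))}"

text \<open>
  Tangent vectors at \<open>p\<close> are derivations of the smooth functions at \<open>p\<close>. The velocity at \<open>0\<close> of the
  curve \<open>\<epsilon> \<mapsto> point (\<gamma> \<epsilon>)\<close> is such a derivation; \<open>restrict\<close> makes equality of tangent
  vectors mean equality on smooth functions.
\<close>

definition velocity :: "'v set \<Rightarrow> (real \<Rightarrow> 'v) \<Rightarrow> ('v set \<Rightarrow> real) \<Rightarrow> real" where
  "velocity p \<gamma> = (\<lambda>f\<in>smooth_functions_at p. deriv (\<lambda>\<epsilon>. f (point scale (\<gamma> \<epsilon>))) 0)"

text \<open>The tangent vector \<open>t\<^sub>\<phi>\<close> at the point represented by \<open>g\<close>.\<close>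

definition tangent_vector :: "'v \<Rightarrow> ('v \<Rightarrow> 'v) \<Rightarrow> ('v set \<Rightarrow> real) \<Rightarrow> real" where
  "tangent_vector g \<phi> = velocity (point scale g) (\<lambda>\<epsilon>. g + \<epsilon> *\<^sub>R \<phi> g)"

text \<open>
  The tangent space at \<open>p\<close> of a submanifold \<open>S\<close> of the projective space, as the set of velocities of
  smooth curves in \<open>S\<close> through \<open>p\<close>. A curve in the projective space is smooth iff it has smooth lifts
  to \<open>V - {0}\<close> locally.
\<close>

definition tangent_space :: "'v set \<Rightarrow> 'v set set \<Rightarrow> (('v set \<Rightarrow> real) \<Rightarrow> real) set" where
  "tangent_space p S = {velocity p \<gamma> | \<gamma> \<delta>. 0 < \<delta> \<and> smooth_on {-\<delta><..<\<delta>} \<gamma> \<and>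
    (\<forall>\<epsilon>\<in>{-\<delta><..<\<delta>}. \<gamma> \<epsilon> \<noteq> 0 \<and> point scale (\<gamma> \<epsilon>) \<in> S) \<and> point scale (\<gamma> 0) = p}"

end

end

theory Submission
  imports Defs
begin

text \<open>
  Replacing \<open>g2\<close> by the representative \<open>w2 = g2 \<star> inverse \<langle>g1, g2\<rangle>\<close> and writing \<open>w1 = g1\<close> gives
  \<open>\<langle>w1, w2\<rangle> = 1\<close>. If a geodesic plane \<open>W\<close> carries both points, then the reality of the form on \<open>W\<close>
  forces the two scalars relating \<open>w1, w2\<close> to elements of \<open>W\<close> to agree up to a real factor, so \<open>W\<close> is
  \<open>span {w1, w2} \<star> k\<close> (\<open>geodesic_plane_through\<close>). Hence the geodesic is the projectivization of
  \<open>span {w1, w2}\<close>, its line is the projectivization of \<open>{w1 \<star> a + w2 \<star> b}\<close>, and noneuclidean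
  means that the Gram determinant \<open>m * n - 1\<close>, where \<open>m = \<langle>w1, w1\<rangle>\<close> and \<open>n = \<langle>w2, w2\<rangle>\<close>, is nonzero
  (\<open>geodesic_through_frame\<close>).

  For (i), let \<open>x = w1 \<star> a + w2 \<star> b\<close>. Up to the positive factor \<open>(norm \<langle>g1, g2\<rangle>)\<^sup>2\<close>, \<open>b(x, g1, g2)\<close> is
  \<open>(m * n - 1) (kconj a * b - kconj b * a)\<close>. It vanishes iff \<open>kconj a * b\<close> is real, which holds iff
  \<open>a\<close> and \<open>b\<close> are real multiples of one scalar, i.e. iff \<open>x\<close> lies on the geodesic
  (\<open>circle_iff\<close>).

  For (ii), let \<open>g = w \<star> k\<close> with \<open>w\<close> in \<open>span {w1, w2}\<close>, and let \<open>l\<close> be the product with a nonzero vector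
  of \<open>span {w1, w2}\<close> orthogonal to \<open>w\<close>. The left-hand side of the equation is, up to the same factor,
  minus twice the imaginary part of \<open>kconj k * l (\<phi> g)\<close>, so the equation says that \<open>l (\<phi> g)\<close> is a real
  multiple of \<open>k\<close> (\<open>tangent_circle_iff\<close>). If it is, then \<open>\<phi> g\<close> is the sum of a vector on the line \<open>g\<close>,
  which does not contribute to the tangent vector, and a vector of \<open>span {w1, w2} \<star> k\<close>, which is the
  velocity of a straight line in that plane (\<open>tangent_vector_of_line\<close>). Conversely, tangency is tested
  on the smooth functions \<open>Re (l x * kconj (\<mu> x) * c) / (norm (\<mu> x))\<^sup>2\<close> with \<open>l\<close> and \<open>\<mu>\<close> linear
  functionals (\<open>functional_of_tangent_vector\<close>): if such a function vanishes on a subset, so does its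
  derivative along every tangent vector of that subset. Taking \<open>l\<close> to vanish on the projective line
  shows that \<open>\<phi> g\<close> lies in its plane; taking the orthogonal \<open>l\<close> above and \<open>c\<close> imaginary gives the
  equation.
\<close>

section \<open>Scalars\<close>

lemma kconj_of_real [simp]: "kconj (of_real r :: 'k::conj_div_algebra) = of_real r"
proof (cases "r = 0")
  case True
  have "kconj (0::'k) + kconj 0 = kconj 0"
    using kconj_add[of "0::'k" 0] by simp
  then show ?thesis using True by simp
next
  case False
  have "of_real r * kconj (of_real r :: 'k) = of_real r * of_real r"
    using mult_kconj[of "of_real r :: 'k"] by (simp add: power2_eq_square scaleR_conv_of_real)
  then show ?thesis using False by simp
qed

lemma kconj_0 [simp]: "kconj (0::'k::conj_div_algebra) = 0"
  and kconj_1 [simp]: "kconj (1::'k::conj_div_algebra) = 1"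
  using kconj_of_real[of 0] kconj_of_real[of 1] by simp_all

lemma kconj_scaleR [simp]: "kconj (r *\<^sub>R x) = r *\<^sub>R kconj (x::'k::conj_div_algebra)"
proof -
  have "kconj (of_real r * x) = kconj x * of_real r"
    by (simp add: kconj_mult)
  then show ?thesis
    by (simp add: of_real_def)
qed

lemma kconj_diff: "kconj (x - y) = kconj x - kconj (y::'k::conj_div_algebra)"
  using kconj_add[of "x - y" y] by (simp add: algebra_simps)

lemma norm_kconj [simp]: "norm (kconj x) = norm (x::'k::conj_div_algebra)"
proof (cases "x = 0")
  case False
  have "norm x * norm (kconj x) = norm x * norm x"
    using arg_cong[OF mult_kconj[of x], of norm] by (simp add: norm_mult power2_eq_square)
  then show ?thesis using False by simp
qed simp

lemma kconj_mult_self: "kconj x * x = (norm x)\<^sup>2 *\<^sub>R (1::'k::conj_div_algebra)"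
  using mult_kconj[of "kconj x"] by (simp add: kconj_kconj)

lemma kconj_eq_0_iff [simp]: "kconj x = 0 \<longleftrightarrow> x = (0::'k::conj_div_algebra)"
  by (metis norm_kconj norm_eq_zero)

text \<open>A self-conjugate \<open>x\<close> satisfies \<open>x\<^sup>2 = (norm x)\<^sup>2\<close>, which factors because real scalars are
  central.\<close>

lemma kconj_eq_iff_Reals: "kconj x = x \<longleftrightarrow> x \<in> \<real>" for x :: "'k::conj_div_algebra"
proof
  assume *: "kconj x = x"
  have "(x - of_real (norm x)) * (x + of_real (norm x)) = 0"
    using mult_kconj[of x] * by (simp add: algebra_simps power2_eq_square of_real_def)
  then have "x = of_real (norm x) \<or> x = of_real (- norm x)"
    by (simp add: add_eq_0_iff2)
  then show "x \<in> \<real>"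
    by (metis Reals_of_real)
qed (auto elim: Reals_cases)

lemma scaleR_1_in_Reals [simp]: "r *\<^sub>R (1::'a::real_algebra_1) \<in> \<real>"
  by (simp flip: of_real_def)

lemma real_multiple_iff:
  fixes a b :: "'k::conj_div_algebra"
  assumes "a \<noteq> 0"
  shows "kconj a * b \<in> \<real> \<longleftrightarrow> (\<exists>t. b = t *\<^sub>R a)"
proof
  assume "kconj a * b \<in> \<real>"
  then obtain t where t: "kconj a * b = of_real t" by (auto elim: Reals_cases)
  have "(norm a)\<^sup>2 *\<^sub>R b = a * (kconj a * b)"
    by (simp add: mult_kconj flip: mult.assoc)
  also have "\<dots> = t *\<^sub>R a"
    by (simp add: t of_real_def)
  finally have "b = inverse ((norm a)\<^sup>2) *\<^sub>R t *\<^sub>R a"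
    using assms by (metis left_inverse norm_eq_zero power_eq_0_iff scaleR_one scaleR_scaleR)
  then show "\<exists>t. b = t *\<^sub>R a" by auto
qed (auto simp: kconj_mult_self)

lemma real_multiple_iff_right:
  fixes a b :: "'k::conj_div_algebra"
  assumes "a \<noteq> 0"
  shows "b * kconj a \<in> \<real> \<longleftrightarrow> (\<exists>t. b = t *\<^sub>R a)"
proof -
  have "b * kconj a \<in> \<real> \<longleftrightarrow> kconj (kconj a) * kconj b \<in> \<real>"
    by (metis kconj_eq_iff_Reals kconj_kconj kconj_mult)
  also have "\<dots> \<longleftrightarrow> (\<exists>t. kconj b = t *\<^sub>R kconj a)"
    using assms by (intro real_multiple_iff) simp
  also have "\<dots> \<longleftrightarrow> (\<exists>t. b = t *\<^sub>R a)"
    by (metis kconj_kconj kconj_scaleR)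
  finally show ?thesis .
qed

text \<open>This is what makes (i) work: \<open>a\<close> and \<open>b\<close> are the coordinates of a point with respect to two vectors
  of a geodesic plane, and the right-hand side says that the point has real homogeneous coordinates.\<close>

lemma real_proportional_iff:
  fixes a b :: "'k::conj_div_algebra"
  shows "kconj a * b \<in> \<real> \<longleftrightarrow> (\<exists>r s k. a = r *\<^sub>R k \<and> b = s *\<^sub>R k)"
proof (cases "a = 0")
  case True
  then have "a = 0 *\<^sub>R b \<and> b = 1 *\<^sub>R b" by simp
  then have "\<exists>r s k. a = r *\<^sub>R k \<and> b = s *\<^sub>R k" by blast
  with True show ?thesis by simp
next
  case False
  show ?thesis
  proof
    assume "kconj a * b \<in> \<real>"
    then show "\<exists>r s k. a = r *\<^sub>R k \<and> b = s *\<^sub>R k"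
      using real_multiple_iff[OF False] by (metis scaleR_one)
  qed (auto simp: kconj_mult_self)
qed

text \<open>Twice the real part. Polarizing \<open>norm (x + 1)\<close> yields it as a real number, where \<open>x + kconj x\<close>
  would be a scalar of \<open>'k\<close>.\<close>

definition ktrace :: "'k::conj_div_algebra \<Rightarrow> real" where
  "ktrace x = (norm (x + 1))\<^sup>2 - (norm x)\<^sup>2 - 1"

lemma of_real_ktrace: "of_real (ktrace x) = x + kconj (x::'k::conj_div_algebra)"
proof -
  have sq: "of_real ((norm y)\<^sup>2) = y * kconj y" for y :: 'k
    by (simp add: mult_kconj scaleR_conv_of_real)
  show ?thesis
    by (simp only: ktrace_def of_real_diff of_real_1 sq) (simp add: kconj_add algebra_simps)
qed

lemma ktrace_add: "ktrace (x + y) = ktrace x + ktrace (y::'k::conj_div_algebra)"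
proof -
  have "of_real (ktrace (x + y)) = (of_real (ktrace x + ktrace y) :: 'k)"
    by (simp only: of_real_add of_real_ktrace kconj_add algebra_simps)
  then show ?thesis by (simp only: of_real_eq_iff)
qed

lemma ktrace_scaleR: "ktrace (r *\<^sub>R x) = r * ktrace (x::'k::conj_div_algebra)"
proof -
  have "of_real (ktrace (r *\<^sub>R x)) = (of_real (r * ktrace x) :: 'k)"
    by (simp only: of_real_mult of_real_ktrace kconj_scaleR) (simp add: of_real_def algebra_simps)
  then show ?thesis by (simp only: of_real_eq_iff)
qed

lemma ktrace_of_real [simp]: "ktrace (of_real r :: 'k::conj_div_algebra) = 2 * r"
proof -
  have "of_real (ktrace (of_real r :: 'k)) = (of_real (2 * r) :: 'k)"
    by (simp only: of_real_ktrace kconj_of_real mult_2 of_real_add)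
  then show ?thesis by (simp only: of_real_eq_iff)
qed

text \<open>With \<open>z = kconj y - y\<close> purely imaginary, \<open>ktrace (y * z)\<close> equals \<open>(norm z)\<^sup>2\<close>. So the single real
  linear function \<open>\<lambda>x. ktrace (x * z)\<close>, which vanishes on the real scalars, detects whether \<open>y\<close> is real.\<close>

lemma Reals_if_ktrace_eq_0:
  fixes y :: "'k::conj_div_algebra"
  assumes "ktrace (y * (kconj y - y)) = 0"
  shows "y \<in> \<real>"
proof -
  let ?z = "kconj y - y"
  have "of_real (ktrace (y * ?z)) = y * ?z - ?z * kconj y"
    by (simp only: of_real_ktrace kconj_mult kconj_diff kconj_kconj) (simp add: algebra_simps)
  also have "\<dots> = ?z * kconj ?z"
    by (simp add: kconj_diff kconj_kconj algebra_simps mult_kconj kconj_mult_self)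
  finally have "?z = 0"
    using assms by (simp add: mult_kconj)
  then show ?thesis by (simp add: kconj_eq_iff_Reals)
qed


section \<open>Maps of class C^k\<close>

text \<open>Openness is essential: the derivatives in \<open>Ck_on\<close> are taken in the whole space, so they are
  determined by the values on \<open>S\<close> only if \<open>S\<close> is open.\<close>

lemma Ck_on_cong:
  assumes "open S" "\<And>x. x \<in> S \<Longrightarrow> f x = g x"
  shows "Ck_on n S f \<longleftrightarrow> Ck_on n S g"
  using assms(2)
proof (induction n arbitrary: f g)
  case 0
  then show ?case by (auto cong: continuous_on_cong)
next
  case (Suc n)
  have der: "(f has_derivative D) (at x) \<longleftrightarrow> (g has_derivative D) (at x)" if "x \<in> S" for x D
    using has_derivative_transform_within_open[OF _ \<open>open S\<close> that] Suc.prems by metis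
  have "f differentiable (at x) \<longleftrightarrow> g differentiable (at x)" if "x \<in> S" for x
    using der[OF that] by (simp add: differentiable_def)
  moreover have "Ck_on n S (\<lambda>x. frechet_derivative f (at x) v)
      \<longleftrightarrow> Ck_on n S (\<lambda>x. frechet_derivative g (at x) v)" for v
    by (rule Suc.IH) (simp add: frechet_derivative_def der)
  ultimately show ?case by simp
qed

lemma Ck_on_SucI:
  assumes "open S" "\<And>x. x \<in> S \<Longrightarrow> (f has_derivative f' x) (at x)"
    and "\<And>v. Ck_on n S (\<lambda>x. f' x v)"
  shows "Ck_on (Suc n) S f"
proof -
  have "Ck_on n S (\<lambda>x. frechet_derivative f (at x) v)" for v
    using assms(3)[of v]
    by (subst Ck_on_cong[OF \<open>open S\<close>, where g = "\<lambda>x. f' x v"]) (simp_all add: frechet_derivative_at[OF assms(2), symmetric])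
  then show ?thesis
    using assms(2) by (auto simp: differentiable_def)
qed

lemma Ck_on_SucD:
  assumes "Ck_on (Suc n) S f"
  shows "Ck_on n S f"
  using assms
proof (induction n arbitrary: f)
  case 0
  then show ?case
    by (auto intro!: continuous_at_imp_continuous_on differentiable_imp_continuous_within)
qed auto

lemma Ck_on_const: "Ck_on n S (\<lambda>_. c)"
  by (induction n arbitrary: c) auto

lemma Ck_on_ident: "open S \<Longrightarrow> Ck_on n S (\<lambda>x. x)"
  by (cases n) (auto intro!: Ck_on_SucI[where f' = "\<lambda>_ v. v"] Ck_on_const)

lemma Ck_on_add:
  assumes "open S" "Ck_on n S f" "Ck_on n S g"
  shows "Ck_on n S (\<lambda>x. f x + g x)"
  using assms(2,3)
proof (induction n arbitrary: f g)
  case 0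
  then show ?case by (auto intro: continuous_intros)
next
  case (Suc n)
  show ?case
    by (rule Ck_on_SucI[OF \<open>open S\<close>, where f' =
          "\<lambda>x v. frechet_derivative f (at x) v + frechet_derivative g (at x) v"])
      (use Suc in \<open>auto intro!: has_derivative_add simp flip: frechet_derivative_works\<close>)
qed

lemma Ck_on_bilinear:
  assumes "bounded_bilinear h" "open S" "Ck_on n S f" "Ck_on n S g"
  shows "Ck_on n S (\<lambda>x. h (f x) (g x))"
  using assms(3,4)
proof (induction n arbitrary: f g)
  case 0
  then show ?case by (auto intro: bounded_bilinear.continuous_on[OF assms(1)])
next
  case (Suc n)
  show ?case
  proof (rule Ck_on_SucI[OF \<open>open S\<close>])
    show "((\<lambda>x. h (f x) (g x)) has_derivative
        (\<lambda>v. h (f x) (frechet_derivative g (at x) v) + h (frechet_derivative f (at x) v) (g x)))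
        (at x)" if "x \<in> S" for x
      using that Suc.prems
      by (intro bounded_bilinear.FDERIV[OF assms(1)]) (auto simp flip: frechet_derivative_works)
    show "Ck_on n S (\<lambda>x. h (f x) (frechet_derivative g (at x) v)
        + h (frechet_derivative f (at x) v) (g x))" for v
      using Suc.prems Ck_on_SucD[OF Suc.prems(1)] Ck_on_SucD[OF Suc.prems(2)]
      by (intro Ck_on_add[OF \<open>open S\<close>] Suc.IH) auto
  qed
qed

lemma Ck_on_inverse:
  fixes f :: "'a::real_normed_vector \<Rightarrow> real"
  assumes "open S" "Ck_on n S f" "\<And>x. x \<in> S \<Longrightarrow> f x \<noteq> 0"
  shows "Ck_on n S (\<lambda>x. inverse (f x))"
  using assms(2)
proof (induction n)
  case 0
  then show ?case using assms(3) by (auto intro: continuous_intros)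
next
  case (Suc n)
  note mult = Ck_on_bilinear[OF bounded_bilinear_mult \<open>open S\<close>]
  show ?case
  proof (rule Ck_on_SucI[OF \<open>open S\<close>])
    show "((\<lambda>x. inverse (f x)) has_derivative
        (\<lambda>v. - 1 * (inverse (f x) * (frechet_derivative f (at x) v * inverse (f x))))) (at x)"
      if "x \<in> S" for x
      using that Suc.prems assms(3)
      by (auto intro!: derivative_eq_intros simp flip: frechet_derivative_works)
    show "Ck_on n S (\<lambda>x. - 1 * (inverse (f x) * (frechet_derivative f (at x) v * inverse (f x))))" for v
      using Suc.prems Suc.IH[OF Ck_on_SucD[OF Suc.prems]]
      by (intro mult Ck_on_const) auto
  qed
qed


section \<open>Subspaces and points\<close>

lemma mem_span_pair: "x \<in> span {u, v} \<longleftrightarrow> (\<exists>r s. x = r *\<^sub>R u + s *\<^sub>R (v::'v::real_vector))"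
  by (auto simp: span_insert span_singleton algebra_simps)

context hermitian_space
begin

lemma scale_1 [simp]: "v \<star> 1 = v"
  using scale_of_real[of v 1] by simp

lemma scale_scaleR_right: "v \<star> (r *\<^sub>R k) = r *\<^sub>R (v \<star> k)"
proof -
  have "v \<star> (r *\<^sub>R k) = v \<star> (k * of_real r)"
    by (simp add: of_real_def)
  then show ?thesis by (simp add: scale_mult scale_of_real)
qed

lemma scale_scaleR_left: "(r *\<^sub>R v) \<star> k = r *\<^sub>R (v \<star> k)"
proof -
  have "(r *\<^sub>R v) \<star> k = v \<star> (of_real r * k)"
    by (simp add: scale_mult scale_of_real)
  then show ?thesis by (simp add: scale_scaleR_right flip: scaleR_conv_of_real)
qed

lemma scale_0_right [simp]: "v \<star> 0 = 0"
  using scale_of_real[of v 0] by simp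

lemma scale_0_left [simp]: "0 \<star> k = 0"
  using scale_scaleR_left[of 0 0 k] by simp

lemma scale_inverse [simp]: "k \<noteq> 0 \<Longrightarrow> v \<star> k \<star> inverse k = v" "k \<noteq> 0 \<Longrightarrow> v \<star> inverse k \<star> k = v"
  by (simp_all flip: scale_mult)

lemma scale_eq_0_iff [simp]: "v \<star> k = 0 \<longleftrightarrow> v = 0 \<or> k = 0"
  by (metis scale_0_left scale_0_right scale_inverse(1))

lemma form_scaleR_left: "\<langle>r *\<^sub>R v, w\<rangle> = r *\<^sub>R \<langle>v, w\<rangle>"
  by (metis form_scale_left kconj_of_real scaleR_conv_of_real scale_of_real)

lemma form_scaleR_right: "\<langle>v, r *\<^sub>R w\<rangle> = r *\<^sub>R \<langle>v, w\<rangle>"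
  by (metis form_commute form_scaleR_left kconj_scaleR)

lemma form_self_Reals: "\<langle>v, v\<rangle> \<in> \<real>"
  by (metis form_commute kconj_eq_iff_Reals)

lemma point_scale: "k \<noteq> 0 \<Longrightarrow> point scale (v \<star> k) = point scale v"
  unfolding point_def
proof safe
  fix l assume "k \<noteq> 0"
  show "v \<star> k \<star> l \<in> range ((\<star>) v)" by (simp flip: scale_mult)
  have "v \<star> l = v \<star> k \<star> (inverse k * l)"
    using \<open>k \<noteq> 0\<close> by (simp add: scale_mult)
  then show "v \<star> l \<in> range ((\<star>) (v \<star> k))" by simp
qed

lemma point_eq_iff:
  assumes "x \<noteq> 0"
  shows "point scale x = point scale y \<longleftrightarrow> (\<exists>k. x = y \<star> k)"
proof
  assume "point scale x = point scale y"
  moreover have "x \<in> point scale x"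
    unfolding point_def using scale_1[of x] by (metis rangeI)
  ultimately show "\<exists>k. x = y \<star> k" by (auto simp: point_def)
qed (use assms in \<open>auto simp: point_scale\<close>)

lemma point_in_projectivize_iff:
  assumes "x \<noteq> 0"
  shows "point scale x \<in> projectivize scale S \<longleftrightarrow> (\<exists>y\<in>S. \<exists>k. x = y \<star> k)"
proof
  assume "point scale x \<in> projectivize scale S"
  then obtain y where "y \<in> S" "point scale x = point scale y"
    by (auto simp: projectivize_def)
  then show "\<exists>y\<in>S. \<exists>k. x = y \<star> k"
    using point_eq_iff[OF assms] by blast
next
  assume "\<exists>y\<in>S. \<exists>k. x = y \<star> k"
  then obtain y k where "y \<in> S" "x = y \<star> k" by blast
  then show "point scale x \<in> projectivize scale S"
    using assms unfolding projectivize_def by (auto simp: point_scale intro!: imageI)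
qed

lemma subspace_if_ksubspace: "ksubspace scale S \<Longrightarrow> subspace S"
  unfolding ksubspace_def subspace_def by (metis scale_of_real)

lemma ksubspace_pair: "ksubspace scale {u \<star> a + v \<star> b |a b. True}"
proof -
  have "(u \<star> a + v \<star> b) + (u \<star> a' + v \<star> b') = u \<star> (a + a') + v \<star> (b + b')" for a b a' b'
    by (simp add: scale_add_right algebra_simps)
  moreover have "(u \<star> a + v \<star> b) \<star> k = u \<star> (a * k) + v \<star> (b * k)" for a b k
    by (simp add: scale_add_left scale_mult)
  moreover have "0 = u \<star> 0 + v \<star> 0" by simp
  ultimately show ?thesis
    unfolding ksubspace_def by blast
qed

text \<open>The factor \<open>k\<close> is allowed because the geodesic plane of a geodesic is determined only up to such a
  factor; the \<open>K\<close>-span does not see it.\<close>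

lemma kspan_pair:
  assumes "k \<noteq> 0"
  shows "kspan scale ((\<lambda>x. x \<star> k) ` span {u, v}) = {u \<star> a + v \<star> b |a b. True}"
  unfolding kspan_def
proof (rule hull_unique)
  have "(r *\<^sub>R u + s *\<^sub>R v) \<star> k = u \<star> (r *\<^sub>R k) + v \<star> (s *\<^sub>R k)" for r s
    by (simp add: scale_add_left scale_scaleR_left scale_scaleR_right)
  then show "(\<lambda>x. x \<star> k) ` span {u, v} \<subseteq> {u \<star> a + v \<star> b |a b. True}"
    by (force simp: mem_span_pair)
  show "ksubspace scale {u \<star> a + v \<star> b |a b. True}" by (rule ksubspace_pair)
  fix T assume sub: "(\<lambda>x. x \<star> k) ` span {u, v} \<subseteq> T" and T: "ksubspace scale T"
  have "u \<star> k \<in> T" "v \<star> k \<in> T"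
    using sub by (auto intro: span_base)
  then have "u \<star> k \<star> (inverse k * a) + v \<star> k \<star> (inverse k * b) \<in> T" for a b
    using T unfolding ksubspace_def by blast
  then show "{u \<star> a + v \<star> b |a b. True} \<subseteq> T"
    using assms by (auto simp: scale_mult)
qed

lemma projectivize_scale:
  assumes "k \<noteq> 0"
  shows "projectivize scale ((\<lambda>x. x \<star> k) ` S) = projectivize scale S"
proof -
  have "(\<lambda>x. x \<star> k) ` S - {0} = (\<lambda>x. x \<star> k) ` (S - {0})"
    using assms by auto
  then show ?thesis
    using assms by (simp add: projectivize_def image_image point_scale)
qed


section \<open>Linear functionals\<close>

definition kfunctional :: "('v \<Rightarrow> 'k) \<Rightarrow> bool" where
  "kfunctional l \<longleftrightarrow> (\<forall>x y. l (x + y) = l x + l y) \<and> (\<forall>x k. l (x \<star> k) = l x * k)"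

lemma kfunctional_linear: "kfunctional l \<Longrightarrow> linear l"
proof (rule linearI)
  assume l: "kfunctional l"
  show "l (x + y) = l x + l y" for x y
    using l by (simp add: kfunctional_def)
  have "l (r *\<^sub>R x) = l x * of_real r" for r x
    using l by (simp add: kfunctional_def flip: scale_of_real)
  then show "l (r *\<^sub>R x) = r *\<^sub>R l x" for r x
    by (simp add: of_real_def)
qed

text \<open>The kernel is a \<open>K\<close>-subspace \<open>H\<close> of maximal real dimension among those containing \<open>S\<close> and avoiding
  \<open>v\<close>. For \<open>x\<close> outside \<open>H\<close>, maximality puts \<open>v\<close> into \<open>H + x \<star> K\<close>, hence \<open>x\<close> into \<open>H + v \<star> K\<close>; the
  functional is the coefficient of \<open>v\<close> in this decomposition.\<close>

lemma separating_kfunctional: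
  assumes "ksubspace scale S" "v \<notin> S"
  obtains l where "kfunctional l" "\<And>x. x \<in> S \<Longrightarrow> l x = 0" "l v = 1"
proof -
  define P where "P H \<longleftrightarrow> ksubspace scale H \<and> S \<subseteq> H \<and> v \<notin> H" for H
  have "\<exists>H. P H \<and> (\<forall>H'. P H' \<longrightarrow> dim H' \<le> dim H)"
    by (rule ex_has_greatest_nat[where k = S and b = "Suc DIM('v)"])
      (use assms in \<open>auto simp: P_def dim_subset_UNIV less_Suc_eq_le\<close>)
  then obtain H where H: "P H" and max: "\<And>H'. P H' \<Longrightarrow> dim H' \<le> dim H" by blast
  have kH: "ksubspace scale H" and "v \<notin> H" and "S \<subseteq> H" using H by (auto simp: P_def)
  then have sub: "subspace H" by (simp add: subspace_if_ksubspace)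
  have scaleH: "x \<star> k \<in> H" if "x \<in> H" for x k
    using kH that by (simp add: ksubspace_def)
  have decomp: "\<exists>c. x - v \<star> c \<in> H" for x
  proof (cases "x \<in> H")
    case True
    then have "x - v \<star> 0 \<in> H" by simp
    then show ?thesis ..
  next
    case False
    define H' where "H' = {h + x \<star> k |h k. h \<in> H}"
    have "H \<subseteq> H'"
      unfolding H'_def using scale_0_right[of x] by (metis (mono_tags, lifting) add.right_neutral mem_Collect_eq subsetI)
    moreover have "x \<in> H'"
      unfolding H'_def using subspace_0[OF sub] scale_1[of x] by (metis (mono_tags, lifting) add_0 mem_Collect_eq)
    moreover have kH': "ksubspace scale H'"
    proof -
      have "(h + x \<star> k) + (h' + x \<star> k') = (h + h') + x \<star> (k + k')" for h k h' k'
        by (simp add: scale_add_right algebra_simps)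
      moreover have "(h + x \<star> k) \<star> l = h \<star> l + x \<star> (k * l)" for h k l
        by (simp add: scale_add_left scale_mult)
      moreover have "0 \<in> H'" using \<open>H \<subseteq> H'\<close> subspace_0[OF sub] by blast
      ultimately show ?thesis
        unfolding ksubspace_def H'_def using kH[unfolded ksubspace_def] by blast
    qed
    ultimately have "dim H < dim H'"
      using False sub by (intro dim_psubset) (auto simp: span_eq_iff[THEN iffD2] subspace_if_ksubspace)
    then have "\<not> P H'"
      using max by (meson not_le)
    then have "v \<in> H'"
      using \<open>H \<subseteq> H'\<close> \<open>S \<subseteq> H\<close> kH' by (auto simp: P_def)
    then obtain h k where hk: "v = h + x \<star> k" "h \<in> H" by (auto simp: H'_def)
    then have "k \<noteq> 0" using \<open>v \<notin> H\<close> by auto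
    have "v \<star> inverse k = h \<star> inverse k + x"
      using \<open>k \<noteq> 0\<close> hk by (simp add: scale_add_left)
    then have "x - v \<star> inverse k = - (h \<star> inverse k)" by simp
    then show ?thesis
      using hk scaleH subspace_neg[OF sub] by metis
  qed
  have unique: "c = d" if "x - v \<star> c \<in> H" "x - v \<star> d \<in> H" for x c d
  proof (rule ccontr)
    assume "c \<noteq> d"
    have "(x - v \<star> d) - (x - v \<star> c) = v \<star> (c - d)"
      using scale_add_right[of v "c - d" d] by simp
    then have "v \<star> (c - d) \<star> inverse (c - d) \<in> H"
      using that subspace_diff[OF sub] scaleH by metis
    then show False using \<open>c \<noteq> d\<close> \<open>v \<notin> H\<close> by simp
  qed
  define l where "l x = (THE c. x - v \<star> c \<in> H)" for x
  have l_eq: "l x = c" if "x - v \<star> c \<in> H" for x c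
    unfolding l_def using that unique by blast
  have l: "x - v \<star> l x \<in> H" for x
    using decomp[of x] l_eq by metis
  show thesis
  proof
    show "kfunctional l"
      unfolding kfunctional_def
    proof (intro conjI allI l_eq)
      fix x y k
      have "x + y - v \<star> (l x + l y) = (x - v \<star> l x) + (y - v \<star> l y)"
        by (simp add: scale_add_right)
      then show "x + y - v \<star> (l x + l y) \<in> H"
        using l subspace_add[OF sub] by metis
      have "x \<star> k - v \<star> (l x * k) = (x - v \<star> l x) \<star> k"
        using scale_add_left[of "x - v \<star> l x" "v \<star> l x" k] by (simp add: scale_mult)
      then show "x \<star> k - v \<star> (l x * k) \<in> H"
        using l scaleH by metis
    qed
    show "l x = 0" if "x \<in> S" for x
      using that \<open>S \<subseteq> H\<close> by (auto intro!: l_eq)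
    show "l v = 1"
      using subspace_0[OF sub] by (auto intro!: l_eq)
  qed
qed


section \<open>Tangent vectors\<close>

text \<open>The quotient descends to the projective space: both numerator and denominator are multiplied by
  \<open>(norm k)\<^sup>2\<close> when \<open>x\<close> is replaced by \<open>x \<star> k\<close>. It is smooth where \<open>m\<close> does not vanish, being there a
  quotient of real quadratic forms with nonzero denominator.\<close>

lemma test_function:
  assumes l: "kfunctional l" and m: "kfunctional m" and "m g \<noteq> 0"
  obtains f where "f \<in> smooth_functions_at scale (point scale g)"
    "\<And>x. x \<noteq> 0 \<Longrightarrow> f (point scale x) =
      ktrace (l x * kconj (m x) * c) / ktrace (m x * kconj (m x))"
proof -
  define Q where "Q l c x = ktrace (l x * kconj (m x) * c)" for l c x
  define F where "F x = Q l c x * inverse (Q m 1 x)" for x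
  define U where "U = {x. m x \<noteq> 0}"
  have m0: "m 0 = 0" using linear_0[OF kfunctional_linear[OF m]] .
  have "open U"
  proof -
    have "continuous_on UNIV m"
      using kfunctional_linear[OF m] linear_conv_bounded_linear linear_continuous_on by blast
    then have "open (m -` (- {0}))"
      using open_vimage by blast
    then show ?thesis by (simp add: U_def vimage_def)
  qed
  have smooth_Q: "Ck_on i U (Q l c)" if "kfunctional l" for i l c
  proof -
    have "bilinear (\<lambda>x y. ktrace (l x * kconj (m y) * c))"
      unfolding bilinear_def using kfunctional_linear[OF that] kfunctional_linear[OF m]
      by (auto intro!: linearI simp: linear_add linear_scale kconj_add ktrace_add ktrace_scaleR
          distrib_left distrib_right)
    from Ck_on_bilinear[OF this[unfolded bilinear_conv_bounded_bilinear] \<open>open U\<close>]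
    show ?thesis unfolding Q_def[abs_def] using \<open>open U\<close> by (simp add: Ck_on_ident)
  qed
  have Qm: "Q m 1 x = 2 * (norm (m x))\<^sup>2" for x
    using ktrace_of_real[of "(norm (m x))\<^sup>2", where 'k = 'k] unfolding Q_def
    by (simp only: mult_1_right mult_kconj of_real_def)
  then have "Q m 1 x \<noteq> 0" if "x \<in> U" for x
    using that by (simp add: U_def)
  then have "smooth_on U F"
    unfolding smooth_on_def F_def[abs_def]
    using l m by (auto intro!: Ck_on_bilinear[OF bounded_bilinear_mult \<open>open U\<close>] Ck_on_inverse
        smooth_Q \<open>open U\<close>)
  have F_scale: "F (x \<star> k) = F x" if "k \<noteq> 0" for x k
  proof -
    have "Q l c (x \<star> k) = (norm k)\<^sup>2 * Q l c x" if "kfunctional l" for l c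
    proof -
      have "l (x \<star> k) * kconj (m (x \<star> k)) = l x * (k * kconj k) * kconj (m x)"
        using m that by (simp add: kfunctional_def kconj_mult mult.assoc)
      then show ?thesis
        by (simp add: Q_def mult_kconj ktrace_scaleR)
    qed
    then show ?thesis using l m that by (simp add: F_def)
  qed
  define f where "f p = F (SOME x. x \<noteq> 0 \<and> point scale x = p)" for p
  have f: "f (point scale x) = F x" if "x \<noteq> 0" for x
  proof -
    define y where "y = (SOME y. y \<noteq> 0 \<and> point scale y = point scale x)"
    have "y \<noteq> 0 \<and> point scale y = point scale x"
      unfolding y_def by (rule someI[of _ x]) (use that in simp)
    then obtain k where "y = x \<star> k" "k \<noteq> 0"
      using point_eq_iff[of y x] by auto
    then show ?thesis
      by (simp add: f_def F_scale flip: y_def)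
  qed
  have N: "{x. x \<noteq> 0 \<and> point scale x \<in> projectivize scale U} = U"
  proof safe
    fix x assume "x \<noteq> 0" "point scale x \<in> projectivize scale U"
    then obtain y k where "m y \<noteq> 0" "x = y \<star> k" "k \<noteq> 0"
      by (auto simp: point_in_projectivize_iff U_def)
    then show "x \<in> U" using m by (simp add: U_def kfunctional_def)
  qed (auto simp: U_def m0 projectivize_def)
  have "f \<in> smooth_functions_at scale (point scale g)"
    unfolding smooth_functions_at_def
  proof (intro CollectI exI[of _ "projectivize scale U"] conjI; (subst N)?)
    show "projectivize scale U \<subseteq> projectivize scale UNIV"
      by (auto simp: projectivize_def)
    show "point scale g \<in> projectivize scale U"
      using \<open>m g \<noteq> 0\<close> m0 by (auto simp: projectivize_def U_def)
    have "f (point scale x) = F x" if "x \<in> U" for x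
      using f[of x] that m0 by (cases "x = 0") (auto simp: U_def)
    then show "smooth_on U (\<lambda>x. f (point scale x))"
      using \<open>smooth_on U F\<close> Ck_on_cong[OF \<open>open U\<close>, of "\<lambda>x. f (point scale x)" F]
      by (simp add: smooth_on_def)
  qed fact
  then show thesis
    using that[of f] f by (simp add: F_def Q_def divide_inverse)
qed

text \<open>The test function built from \<open>l\<close>, \<open>m\<close> and \<open>c\<close> vanishes on \<open>T\<close>, hence so does its derivative along any
  curve in \<open>T\<close>. Since \<open>l g = 0\<close>, its derivative along \<open>\<phi> g\<close> involves only the derivative of the factor
  \<open>l x\<close> of the numerator, and is the asserted trace divided by a nonzero number.\<close>

lemma functional_of_tangent_vector:
  assumes l: "kfunctional l" and m: "kfunctional m" and "m g \<noteq> 0" and "l g = 0"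
    and T: "\<And>x. x \<noteq> 0 \<Longrightarrow> point scale x \<in> T \<Longrightarrow> ktrace (l x * kconj (m x) * c) = 0"
    and tang: "tangent_vector scale g \<phi> \<in> tangent_space scale (point scale g) T"
  shows "ktrace (l (\<phi> g) * kconj (m g) * c) = 0"
proof -
  obtain f where f: "f \<in> smooth_functions_at scale (point scale g)"
    and f_eq: "\<And>x. x \<noteq> 0 \<Longrightarrow> f (point scale x) =
      ktrace (l x * kconj (m x) * c) / ktrace (m x * kconj (m x))"
    using test_function[OF l m \<open>m g \<noteq> 0\<close>, where c = c] by blast
  obtain \<gamma> \<delta> where eq: "tangent_vector scale g \<phi> = velocity scale (point scale g) \<gamma>"
    and "0 < \<delta>" and \<gamma>: "\<And>\<epsilon>. \<epsilon> \<in> {-\<delta><..<\<delta>} \<Longrightarrow> \<gamma> \<epsilon> \<noteq> 0 \<and> point scale (\<gamma> \<epsilon>) \<in> T"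
    using tang unfolding tangent_space_def by auto
  have "((\<lambda>\<epsilon>. f (point scale (\<gamma> \<epsilon>))) has_real_derivative 0) (at 0)"
    by (rule has_field_derivative_transform_within_open[OF DERIV_const[of 0], of "{-\<delta><..<\<delta>}"])
      (use \<gamma> \<open>0 < \<delta>\<close> in \<open>auto simp: f_eq T\<close>)
  then have "deriv (\<lambda>\<epsilon>. f (point scale (\<gamma> \<epsilon>))) 0 = 0"
    by (rule DERIV_imp_deriv)
  then have deriv_f: "deriv (\<lambda>\<epsilon>. f (point scale (g + \<epsilon> *\<^sub>R \<phi> g))) 0 = 0"
    using fun_cong[OF eq, of f] f by (simp add: tangent_vector_def velocity_def)
  define U where "U = {\<epsilon>. m g + \<epsilon> *\<^sub>R m (\<phi> g) \<noteq> 0}"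
  note lin = linear_add linear_scale linear_0
  note lin_l = lin[OF kfunctional_linear[OF l]] and lin_m = lin[OF kfunctional_linear[OF m]]
  have "open U"
    unfolding U_def by (rule open_Collect_neq) (auto intro!: continuous_intros)
  define A B where "A = ktrace (l (\<phi> g) * kconj (m g) * c)"
    and "B = ktrace (l (\<phi> g) * kconj (m (\<phi> g)) * c)"
  define D where "D = ktrace (m g * kconj (m g))"
  define D1 where "D1 = ktrace (m g * kconj (m (\<phi> g)) + m (\<phi> g) * kconj (m g))"
  define D2 where "D2 = ktrace (m (\<phi> g) * kconj (m (\<phi> g)))"
  have "D = 2 * (norm (m g))\<^sup>2"
    using ktrace_of_real[of "(norm (m g))\<^sup>2", where 'k = 'k] unfolding D_def
    by (simp only: mult_kconj of_real_def)
  then have "D \<noteq> 0" using \<open>m g \<noteq> 0\<close> by simp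
  have f_line: "\<epsilon> * (A + \<epsilon> * B) / (D + \<epsilon> * (D1 + \<epsilon> * D2)) = f (point scale (g + \<epsilon> *\<^sub>R \<phi> g))"
    if "\<epsilon> \<in> U" for \<epsilon>
  proof -
    have "m (g + \<epsilon> *\<^sub>R \<phi> g) \<noteq> 0"
      using that by (simp add: U_def lin_m)
    then have "g + \<epsilon> *\<^sub>R \<phi> g \<noteq> 0"
      using lin_m(3) by metis
    then show ?thesis
      by (simp add: f_eq lin_l lin_m \<open>l g = 0\<close> A_def B_def D_def D1_def D2_def kconj_add
          ktrace_add ktrace_scaleR distrib_left distrib_right add_ac mult.assoc)
  qed
  have "((\<lambda>\<epsilon>. \<epsilon> * (A + \<epsilon> * B) / (D + \<epsilon> * (D1 + \<epsilon> * D2))) has_real_derivative A / D) (at 0)"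
    using \<open>D \<noteq> 0\<close> by (auto intro!: derivative_eq_intros)
  then have "((\<lambda>\<epsilon>. f (point scale (g + \<epsilon> *\<^sub>R \<phi> g))) has_real_derivative A / D) (at 0)"
    by (rule has_field_derivative_transform_within_open[OF _ \<open>open U\<close>])
      (use \<open>m g \<noteq> 0\<close> f_line in \<open>auto simp: U_def\<close>)
  then have "A / D = 0"
    using DERIV_imp_deriv deriv_f by metis
  then show ?thesis
    using \<open>D \<noteq> 0\<close> by (simp add: A_def)
qed

text \<open>The lift of a smooth function is constant on the line \<open>g\<close>, so its derivative in the direction \<open>g \<star> c\<close> is
  zero and only \<open>u\<close> contributes.\<close>

lemma tangent_vector_of_line:
  assumes "g \<noteq> 0" and \<phi>: "\<phi> g = g \<star> c + u"
    and T: "\<And>\<epsilon>. g + \<epsilon> *\<^sub>R u \<noteq> 0 \<and> point scale (g + \<epsilon> *\<^sub>R u) \<in> T"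
  shows "tangent_vector scale g \<phi> \<in> tangent_space scale (point scale g) T"
proof -
  have deriv_eq: "deriv (\<lambda>\<epsilon>. f (point scale (g + \<epsilon> *\<^sub>R \<phi> g))) 0
      = deriv (\<lambda>\<epsilon>. f (point scale (g + \<epsilon> *\<^sub>R u))) 0"
    if "f \<in> smooth_functions_at scale (point scale g)" for f
  proof -
    define F where "F x = f (point scale x)" for x
    from that obtain N where "point scale g \<in> N" "smooth_on {x. x \<noteq> 0 \<and> point scale x \<in> N} F"
      unfolding smooth_functions_at_def F_def[abs_def] mem_Collect_eq by (elim exE conjE)
    then have "Ck_on (Suc 0) {x. x \<noteq> 0 \<and> point scale x \<in> N} F"
      by (simp only: smooth_on_def)
    then have "F differentiable (at g)"
      using \<open>point scale g \<in> N\<close> \<open>g \<noteq> 0\<close> by auto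
    then obtain D where D: "(F has_derivative D) (at g)"
      by (auto simp: differentiable_def)
    have line: "((\<lambda>\<epsilon>. F (g + \<epsilon> *\<^sub>R v)) has_real_derivative D v) (at 0)" for v
    proof -
      have "((\<lambda>\<epsilon>. g + \<epsilon> *\<^sub>R v) has_derivative (\<lambda>\<epsilon>. \<epsilon> *\<^sub>R v)) (at 0)"
        by (auto intro!: derivative_eq_intros)
      from diff_chain_at[OF this, of F D] D
      have "((\<lambda>\<epsilon>. F (g + \<epsilon> *\<^sub>R v)) has_derivative (\<lambda>\<epsilon>. D (\<epsilon> *\<^sub>R v))) (at 0)"
        by (simp add: o_def)
      moreover have "(\<lambda>\<epsilon>. D (\<epsilon> *\<^sub>R v)) = (*) (D v)"
        using linear_scale[OF has_derivative_linear[OF D]] by (simp add: mult.commute fun_eq_iff)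
      ultimately show ?thesis by (simp add: has_field_derivative_def)
    qed
    define U where "U = {\<epsilon>. 1 + \<epsilon> *\<^sub>R c \<noteq> 0}"
    have "open U"
      unfolding U_def by (rule open_Collect_neq) (auto intro!: continuous_intros)
    have "F g = F (g + \<epsilon> *\<^sub>R (g \<star> c))" if "\<epsilon> \<in> U" for \<epsilon>
    proof -
      have "g + \<epsilon> *\<^sub>R (g \<star> c) = g \<star> (1 + \<epsilon> *\<^sub>R c)"
        by (simp add: scale_add_right scale_scaleR_right)
      then show ?thesis
        using that by (simp add: F_def U_def point_scale)
    qed
    then have "((\<lambda>\<epsilon>. F (g + \<epsilon> *\<^sub>R (g \<star> c))) has_real_derivative 0) (at 0)"
      by (intro has_field_derivative_transform_within_open[OF DERIV_const[of "F g"] \<open>open U\<close>])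
        (auto simp: U_def)
    then have "D (g \<star> c) = 0"
      using line[of "g \<star> c"] DERIV_unique by blast
    then have "D (\<phi> g) = D u"
      using linear_add[OF has_derivative_linear[OF D]] \<phi> by simp
    then show ?thesis
      using line[of "\<phi> g"] line[of u] by (simp add: F_def DERIV_imp_deriv)
  qed
  have "smooth_on {-1<..<1} (\<lambda>\<epsilon>. g + \<epsilon> *\<^sub>R u)"
    unfolding smooth_on_def
    by (intro allI Ck_on_add Ck_on_bilinear[OF bounded_bilinear_scaleR] Ck_on_const Ck_on_ident) auto
  moreover have "tangent_vector scale g \<phi> = velocity scale (point scale g) (\<lambda>\<epsilon>. g + \<epsilon> *\<^sub>R u)"
    unfolding tangent_vector_def velocity_def by (intro restrict_ext deriv_eq)
  ultimately show ?thesis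
    unfolding tangent_space_def
    by (intro CollectI exI[of _ "\<lambda>\<epsilon>. g + \<epsilon> *\<^sub>R u"] exI[of _ 1] conjI) (use T in auto)
qed

end


section \<open>Equations of a noneuclidean geodesic\<close>

text \<open>The two vectors span a geodesic plane. Their Gram determinant is \<open>m * n - 1\<close>, so the last
  axiom says that the form is nondegenerate on their \<open>K\<close>-span; it also makes the vectors independent
  over \<open>K\<close>.\<close>

locale geodesic_frame = hermitian_space scale form
  for scale :: "'v::euclidean_space \<Rightarrow> 'k::conj_div_algebra \<Rightarrow> 'v" (infixl "\<star>" 75)
    and form :: "'v \<Rightarrow> 'v \<Rightarrow> 'k" ("\<langle>_, _\<rangle>") +
  fixes w1 w2 :: 'v and m n :: real
  assumes form_11: "\<langle>w1, w1\<rangle> = of_real m" and form_22: "\<langle>w2, w2\<rangle> = of_real n"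
    and form_12: "\<langle>w1, w2\<rangle> = 1" and nondegenerate: "m * n \<noteq> 1"
begin

lemma form_21: "\<langle>w2, w1\<rangle> = 1"
  using form_commute[of w2 w1] form_12 by simp

lemma form_w:
  "\<langle>w1, w1 \<star> a + w2 \<star> b\<rangle> = m *\<^sub>R a + b" "\<langle>w2, w1 \<star> a + w2 \<star> b\<rangle> = a + n *\<^sub>R b"
  "\<langle>w1 \<star> a + w2 \<star> b, w1\<rangle> = m *\<^sub>R kconj a + kconj b"
  "\<langle>w1 \<star> a + w2 \<star> b, w2\<rangle> = kconj a + n *\<^sub>R kconj b"
  by (simp_all add: form_add_left form_add_right form_scale_left form_scale_right
      form_11 form_12 form_21 form_22 scaleR_conv_of_real) (simp_all add: of_real_def)

lemma real_combination_scale: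
  "(r *\<^sub>R w1 + s *\<^sub>R w2) \<star> k = w1 \<star> (r *\<^sub>R k) + w2 \<star> (s *\<^sub>R k)"
  by (simp add: scale_add_left scale_scaleR_left scale_scaleR_right)

lemma w_independent: "w1 \<star> a + w2 \<star> b = w1 \<star> a' + w2 \<star> b' \<longleftrightarrow> a = a' \<and> b = b'"
proof
  assume *: "w1 \<star> a + w2 \<star> b = w1 \<star> a' + w2 \<star> b'"
  have 1: "m *\<^sub>R a + b = m *\<^sub>R a' + b'" and 2: "a + n *\<^sub>R b = a' + n *\<^sub>R b'"
    using arg_cong[OF *, of "\<lambda>x. \<langle>w1, x\<rangle>"] arg_cong[OF *, of "\<lambda>x. \<langle>w2, x\<rangle>"] by (simp_all add: form_w)
  have "(m * n - 1) *\<^sub>R (a - a') = 0"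
  proof -
    have "(m * n - 1) *\<^sub>R (a - a') = n *\<^sub>R ((m *\<^sub>R a + b) - (m *\<^sub>R a' + b'))
        - ((a + n *\<^sub>R b) - (a' + n *\<^sub>R b'))"
      by (simp add: algebra_simps)
    then show ?thesis by (simp add: 1 2)
  qed
  then have "a = a'" using nondegenerate by simp
  then show "a = a' \<and> b = b'" using 1 by simp
qed simp

abbreviation "circle \<equiv> projectivize scale (span {w1, w2})"
abbreviation "plane \<equiv> {w1 \<star> a + w2 \<star> b |a b. True}"

lemma point_in_circle_iff:
  assumes "x \<noteq> 0"
  shows "point scale x \<in> circle \<longleftrightarrow> (\<exists>r s k. x = w1 \<star> (r *\<^sub>R k) + w2 \<star> (s *\<^sub>R k))"
  using point_in_projectivize_iff[OF assms, of "span {w1, w2}"]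
  by (auto simp: mem_span_pair Bex_def real_combination_scale) (metis real_combination_scale)+

lemma point_in_line_iff:
  assumes "x \<noteq> 0"
  shows "point scale x \<in> projectivize scale plane \<longleftrightarrow> x \<in> plane"
proof
  assume "point scale x \<in> projectivize scale plane"
  then obtain y k where "y \<in> plane" "x = y \<star> k"
    using point_in_projectivize_iff[OF assms] by auto
  then show "x \<in> plane"
    using ksubspace_pair[of w1 w2] unfolding ksubspace_def by blast
qed (use assms in \<open>auto simp: projectivize_def\<close>)

text \<open>In coordinates \<open>x = w1 \<star> a + w2 \<star> b\<close>, the expression is \<open>(m * n - 1) (kconj a * b - kconj b * a)\<close>.\<close>

lemma circle_iff:
  assumes "x \<noteq> 0" "point scale x \<in> projectivize scale plane"
  shows "point scale x \<in> circle \<longleftrightarrow> \<langle>x, w1\<rangle> * \<langle>w2, x\<rangle> - \<langle>x, w2\<rangle> * \<langle>w1, x\<rangle> = 0"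
proof -
  obtain a b where x: "x = w1 \<star> a + w2 \<star> b"
    using assms point_in_line_iff by auto
  have "\<langle>x, w1\<rangle> * \<langle>w2, x\<rangle> - \<langle>x, w2\<rangle> * \<langle>w1, x\<rangle>
      = (m * n - 1) *\<^sub>R (kconj a * b - kconj b * a)"
    unfolding x form_w by (simp add: algebra_simps)
  then have "\<langle>x, w1\<rangle> * \<langle>w2, x\<rangle> - \<langle>x, w2\<rangle> * \<langle>w1, x\<rangle> = 0 \<longleftrightarrow> kconj (kconj a * b) = kconj a * b"
    using nondegenerate by (auto simp: kconj_mult kconj_kconj)
  also have "\<dots> \<longleftrightarrow> (\<exists>r s k. a = r *\<^sub>R k \<and> b = s *\<^sub>R k)"
    by (simp only: kconj_eq_iff_Reals real_proportional_iff)
  also have "\<dots> \<longleftrightarrow> point scale x \<in> circle"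
    by (simp add: point_in_circle_iff[OF \<open>x \<noteq> 0\<close>]) (simp add: x w_independent)
  finally show ?thesis by simp
qed

text \<open>The right-hand side is the linearization at \<open>g\<close> of the equation in \<open>circle_iff\<close>. Both sides are
  equivalent to \<open>l (\<phi> g)\<close> being a real multiple of \<open>k\<close>, with \<open>g = w \<star> k\<close> for \<open>w\<close> in \<open>span {w1, w2}\<close> and \<open>l\<close>
  the product with a vector of that span orthogonal to \<open>w\<close>.\<close>

lemma tangent_circle_iff:
  assumes "g \<noteq> 0" "point scale g \<in> circle"
    and tang: "tangent_vector scale g \<phi> \<in> tangent_space scale (point scale g) (projectivize scale plane)"
  shows "tangent_vector scale g \<phi> \<in> tangent_space scale (point scale g) circle \<longleftrightarrow>
    \<langle>\<phi> g, w1\<rangle> * \<langle>w2, g\<rangle> + \<langle>g, w1\<rangle> * \<langle>w2, \<phi> g\<rangle> - \<langle>\<phi> g, w2\<rangle> * \<langle>w1, g\<rangle> - \<langle>g, w2\<rangle> * \<langle>w1, \<phi> g\<rangle> = 0"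
    (is "_ \<longleftrightarrow> ?E = 0")
proof -
  obtain r s k where g: "g = w1 \<star> (r *\<^sub>R k) + w2 \<star> (s *\<^sub>R k)"
    using assms(1,2) point_in_circle_iff by blast
  have "k \<noteq> 0" and rs: "r \<noteq> 0 \<or> s \<noteq> 0" using \<open>g \<noteq> 0\<close> g by auto
  \<comment> \<open>With \<open>w = r *\<^sub>R w1 + s *\<^sub>R w2\<close>, these are the products of \<open>w1\<close> and \<open>w2\<close> with \<open>w\<close>. So
      \<open>B *\<^sub>R w1 - A *\<^sub>R w2\<close> is orthogonal to \<open>w\<close>, while the product of \<open>A *\<^sub>R w1 + B *\<^sub>R w2\<close> with
      \<open>w\<close> is \<open>A\<^sup>2 + B\<^sup>2\<close>, which is nonzero even if \<open>w\<close> is isotropic.\<close>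
  define A B where "A = r * m + s" and "B = r + s * n"
  define l where "l x = B *\<^sub>R \<langle>w1, x\<rangle> - A *\<^sub>R \<langle>w2, x\<rangle>" for x
  define \<mu> where "\<mu> x = A *\<^sub>R \<langle>w1, x\<rangle> + B *\<^sub>R \<langle>w2, x\<rangle>" for x
  have l: "kfunctional l" and \<mu>: "kfunctional \<mu>"
    by (simp_all add: kfunctional_def l_def \<mu>_def form_add_right form_scale_right algebra_simps)
  have AB: "A \<noteq> 0 \<or> B \<noteq> 0"
  proof (rule ccontr)
    assume "\<not> ?thesis"
    then have "s = - r * m" "r = - s * n" by (simp_all add: A_def B_def algebra_simps)
    then have "(m * n - 1) * r = 0" "(m * n - 1) * s = 0" by algebra+
    then show False using nondegenerate rs by simp
  qed
  have g_w: "\<langle>w1, g\<rangle> = A *\<^sub>R k" "\<langle>w2, g\<rangle> = B *\<^sub>R k" "\<langle>g, w1\<rangle> = A *\<^sub>R kconj k" "\<langle>g, w2\<rangle> = B *\<^sub>R kconj k"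
    unfolding g form_w by (simp_all add: A_def B_def algebra_simps)
  have "l g = 0" by (simp add: l_def g_w)
  have \<mu>_g: "\<mu> g = (A\<^sup>2 + B\<^sup>2) *\<^sub>R k"
    by (simp add: \<mu>_def g_w power2_eq_square algebra_simps)
  have "A\<^sup>2 + B\<^sup>2 \<noteq> 0"
    using AB by (simp add: sum_power2_eq_zero_iff)
  then have "\<mu> g \<noteq> 0"
    using \<open>k \<noteq> 0\<close> by (simp only: \<mu>_g scaleR_eq_0_iff) simp
  have "\<phi> g \<in> plane"
  proof (rule ccontr)
    assume "\<phi> g \<notin> plane"
    then obtain l' where l': "kfunctional l'" "\<And>x. x \<in> plane \<Longrightarrow> l' x = 0" "l' (\<phi> g) = 1"
      using separating_kfunctional[OF ksubspace_pair \<open>\<phi> g \<notin> plane\<close>] by blast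
    \<comment> \<open>The constant \<open>inverse (kconj (\<mu> g))\<close> makes the argument of the trace equal to 1, since \<open>l' (\<phi> g) = 1\<close>.\<close>
    have "ktrace (l' (\<phi> g) * kconj (\<mu> g) * inverse (kconj (\<mu> g))) = 0"
    proof (rule functional_of_tangent_vector[OF l'(1) \<mu> \<open>\<mu> g \<noteq> 0\<close> _ _ tang])
      have "g \<in> plane" using g by blast
      then show "l' g = 0" by (rule l'(2))
      fix x assume "x \<noteq> 0" "point scale x \<in> projectivize scale plane"
      then have "x \<in> plane" by (rule point_in_line_iff[THEN iffD1])
      then have "l' x = 0" by (rule l'(2))
      then show "ktrace (l' x * kconj (\<mu> x) * inverse (kconj (\<mu> g))) = 0"
        using ktrace_of_real[of 0, where 'k = 'k] by simp
    qed
    then show False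
      using l'(3) \<open>\<mu> g \<noteq> 0\<close> ktrace_of_real[of 1, where 'k = 'k] by simp
  qed
  then obtain a b where v: "\<phi> g = w1 \<star> a + w2 \<star> b" by blast
  have l_v: "l (\<phi> g) = (m * n - 1) *\<^sub>R (s *\<^sub>R a - r *\<^sub>R b)"
    unfolding l_def v form_w by (simp add: A_def B_def algebra_simps)
  have "?E = kconj (kconj k * l (\<phi> g)) - kconj k * l (\<phi> g)"
    unfolding g_w unfolding v form_w l_def
    by (simp add: kconj_mult kconj_kconj kconj_diff kconj_add algebra_simps)
  then have "?E = 0 \<longleftrightarrow> kconj k * l (\<phi> g) \<in> \<real>"
    by (simp flip: kconj_eq_iff_Reals)
  also have "\<dots> \<longleftrightarrow> (\<exists>t. l (\<phi> g) = t *\<^sub>R k)"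
    by (rule real_multiple_iff[OF \<open>k \<noteq> 0\<close>])
  finally have E_iff: "?E = 0 \<longleftrightarrow> (\<exists>t. l (\<phi> g) = t *\<^sub>R k)" .
  show ?thesis
    unfolding E_iff
  proof
    assume tang: "tangent_vector scale g \<phi> \<in> tangent_space scale (point scale g) circle"
    define y where "y = l (\<phi> g) * kconj (\<mu> g)"
    have "of_real (ktrace (kconj y - y)) = (of_real 0 :: 'k)"
      by (simp add: of_real_ktrace kconj_diff kconj_kconj)
    then have tr0: "ktrace (kconj y - y) = 0" by (simp only: of_real_eq_iff)
    have "ktrace (l (\<phi> g) * kconj (\<mu> g) * (kconj y - y)) = 0"
    proof (rule functional_of_tangent_vector[OF l \<mu> \<open>\<mu> g \<noteq> 0\<close> \<open>l g = 0\<close> _ tang])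
      fix x assume "x \<noteq> 0" "point scale x \<in> circle"
      then obtain r' s' k' where x: "x = w1 \<star> (r' *\<^sub>R k') + w2 \<star> (s' *\<^sub>R k')"
        using point_in_circle_iff by blast
      have "l x = (B * (m * r' + s') - A * (r' + n * s')) *\<^sub>R k'"
        and "\<mu> x = (A * (m * r' + s') + B * (r' + n * s')) *\<^sub>R k'"
        unfolding l_def \<mu>_def x form_w by (simp_all add: algebra_simps)
      then show "ktrace (l x * kconj (\<mu> x) * (kconj y - y)) = 0"
        by (simp add: mult_kconj ktrace_scaleR tr0)
    qed
    then have "y \<in> \<real>" by (intro Reals_if_ktrace_eq_0) (simp only: y_def)
    then obtain t where "l (\<phi> g) = t *\<^sub>R \<mu> g"
      unfolding y_def using real_multiple_iff_right[OF \<open>\<mu> g \<noteq> 0\<close>] by blast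
    then show "\<exists>t. l (\<phi> g) = t *\<^sub>R k"
      by (auto simp: \<mu>_g)
  next
    assume "\<exists>t. l (\<phi> g) = t *\<^sub>R k"
    then obtain t where "(m * n - 1) *\<^sub>R (s *\<^sub>R a - r *\<^sub>R b) = t *\<^sub>R k"
      by (auto simp: l_v)
    then have "inverse (m * n - 1) *\<^sub>R (m * n - 1) *\<^sub>R (s *\<^sub>R a - r *\<^sub>R b)
        = inverse (m * n - 1) *\<^sub>R t *\<^sub>R k"
      by (simp only:)
    then have t: "s *\<^sub>R a - r *\<^sub>R b = (inverse (m * n - 1) * t) *\<^sub>R k"
      using nondegenerate by simp
    define N where "N = r\<^sup>2 + s\<^sup>2"
    have "N \<noteq> 0" using rs by (simp add: N_def sum_power2_eq_zero_iff)
    \<comment> \<open>The coordinates of \<open>\<phi> g\<close> decompose as \<open>(a, b) = (r, s) d + (s, - r) \<tau> k\<close>; the first summand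
        gives a vector of the line \<open>g\<close> and the second one lies in \<open>span {w1, w2} \<star> k\<close>.\<close>
    define \<tau> where "\<tau> = inverse N * (inverse (m * n - 1) * t)"
    define d where "d = inverse N *\<^sub>R (r *\<^sub>R a + s *\<^sub>R b)"
    define u where "u = w1 \<star> ((\<tau> * s) *\<^sub>R k) + w2 \<star> ((- \<tau> * r) *\<^sub>R k)"
    have \<tau>: "\<tau> *\<^sub>R k = inverse N *\<^sub>R (s *\<^sub>R a - r *\<^sub>R b)"
      by (simp add: t \<tau>_def)
    have "r *\<^sub>R d + s *\<^sub>R (\<tau> *\<^sub>R k) = (inverse N * (r * r + s * s)) *\<^sub>R a"
      unfolding \<tau> d_def by (simp add: algebra_simps)
    moreover have "s *\<^sub>R d - r *\<^sub>R (\<tau> *\<^sub>R k) = (inverse N * (r * r + s * s)) *\<^sub>R b"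
      unfolding \<tau> d_def by (simp add: algebra_simps)
    moreover have "inverse N * (r * r + s * s) = 1"
      using \<open>N \<noteq> 0\<close> by (simp add: N_def power2_eq_square)
    ultimately have a: "a = r *\<^sub>R d + (\<tau> * s) *\<^sub>R k" and b: "b = s *\<^sub>R d + (- \<tau> * r) *\<^sub>R k"
      by (simp_all add: mult.commute)
    have g_d: "g \<star> (inverse k * d) = w1 \<star> (r *\<^sub>R d) + w2 \<star> (s *\<^sub>R d)"
      using \<open>k \<noteq> 0\<close> by (simp add: g scale_add_left flip: scale_mult mult.assoc)
    have split: "\<phi> g = g \<star> (inverse k * d) + u"
      by (simp only: v a b u_def g_d scale_add_right add_ac)
    show "tangent_vector scale g \<phi> \<in> tangent_space scale (point scale g) circle"
    proof (rule tangent_vector_of_line[where \<phi> = \<phi>, OF \<open>g \<noteq> 0\<close> split])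
      fix \<epsilon> :: real
      define r' s' where "r' = r + \<epsilon> * \<tau> * s" and "s' = s - \<epsilon> * \<tau> * r"
      have line: "g + \<epsilon> *\<^sub>R u = w1 \<star> (r' *\<^sub>R k) + w2 \<star> (s' *\<^sub>R k)"
      proof -
        have "g + \<epsilon> *\<^sub>R u = w1 \<star> (r *\<^sub>R k + \<epsilon> *\<^sub>R (\<tau> * s) *\<^sub>R k) + w2 \<star> (s *\<^sub>R k + \<epsilon> *\<^sub>R (- \<tau> * r) *\<^sub>R k)"
          by (simp only: g u_def scale_add_right scale_scaleR_right scaleR_add_right add_ac)
        then show ?thesis by (simp add: r'_def s'_def algebra_simps)
      qed
      \<comment> \<open>The displacement \<open>(s, - r)\<close> is perpendicular to \<open>(r, s)\<close>, so the line avoids the origin.\<close>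
      have "r * r' + s * s' = N"
        by (simp add: r'_def s'_def N_def power2_eq_square algebra_simps)
      then have "r' \<noteq> 0 \<or> s' \<noteq> 0" using \<open>N \<noteq> 0\<close> by auto
      then have "g + \<epsilon> *\<^sub>R u \<noteq> 0"
        using w_independent[of "r' *\<^sub>R k" "s' *\<^sub>R k" 0 0] \<open>k \<noteq> 0\<close> by (auto simp: line)
      then show "g + \<epsilon> *\<^sub>R u \<noteq> 0 \<and> point scale (g + \<epsilon> *\<^sub>R u) \<in> circle"
        using point_in_circle_iff line by blast
    qed
  qed
qed

end


section \<open>The geodesic through two points\<close>

context hermitian_space
begin

text \<open>Let \<open>g1 = y1 \<star> a\<close> and \<open>g2 = y2 \<star> b\<close> with \<open>y1\<close>, \<open>y2\<close> in \<open>W\<close>. Then \<open>\<langle>g1, g2\<rangle>\<close> is a real multiple of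
  \<open>kconj a * b\<close>, and \<open>b * inverse (kconj a * b)\<close> is a real multiple of \<open>a\<close>. So the normalized second
  vector is a real multiple of \<open>y2 \<star> a\<close>, with the same scalar \<open>a\<close> as the first one.\<close>

lemma geodesic_plane_through:
  assumes "g1 \<noteq> 0" "g2 \<noteq> 0" "point scale g1 \<noteq> point scale g2" "\<langle>g1, g2\<rangle> \<noteq> 0"
    and W: "geodesic_plane form W"
    and "point scale g1 \<in> projectivize scale W" "point scale g2 \<in> projectivize scale W"
  shows "\<exists>k. k \<noteq> 0 \<and> W = (\<lambda>x. x \<star> k) ` span {g1, g2 \<star> inverse \<langle>g1, g2\<rangle>}"
proof -
  obtain y1 a y2 b where y: "y1 \<in> W" "y2 \<in> W" and g: "g1 = y1 \<star> a" "g2 = y2 \<star> b"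
    using assms point_in_projectivize_iff by metis
  then have nz: "a \<noteq> 0" "b \<noteq> 0" "y1 \<noteq> 0" "y2 \<noteq> 0" using assms(1,2) by auto
  obtain s where s: "\<langle>y1, y2\<rangle> = of_real s"
    using W y by (auto simp: geodesic_plane_def elim!: Reals_cases)
  have form_g: "\<langle>g1, g2\<rangle> = s *\<^sub>R (kconj a * b)"
    by (simp add: g s form_scale_left form_scale_right) (simp add: of_real_def)
  then have "s \<noteq> 0" using assms(4) by auto
  define w2 where "w2 = g2 \<star> inverse \<langle>g1, g2\<rangle>"
  have "inverse (kconj a) = inverse ((norm a)\<^sup>2) *\<^sub>R a"
    by (rule inverse_unique) (simp add: kconj_mult_self nz)
  moreover have "inverse \<langle>g1, g2\<rangle> = inverse s *\<^sub>R (inverse b * inverse (kconj a))"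
    using nz by (simp add: form_g nonzero_inverse_mult_distrib inverse_scaleR_distrib)
  ultimately have "b * inverse \<langle>g1, g2\<rangle> = (inverse s * inverse ((norm a)\<^sup>2)) *\<^sub>R a"
    using nz by (simp flip: mult.assoc)
  then have w2: "w2 = (inverse s * inverse ((norm a)\<^sup>2)) *\<^sub>R (y2 \<star> a)"
    by (simp add: w2_def g scale_scaleR_right flip: scale_mult)
  define \<rho> where "\<rho> = s * (norm a)\<^sup>2"
  have "\<rho> \<noteq> 0" using \<open>s \<noteq> 0\<close> nz by (simp add: \<rho>_def)
  have y2a: "y2 \<star> a = \<rho> *\<^sub>R w2"
  proof -
    have "\<rho> * (inverse s * inverse ((norm a)\<^sup>2)) = 1"
      using \<open>s \<noteq> 0\<close> nz by (simp add: \<rho>_def field_simps)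
    then show ?thesis by (simp add: w2)
  qed
  have indep: "independent {y1, y2}" and "y1 \<noteq> y2"
  proof -
    have no: "y2 \<noteq> r *\<^sub>R y1" for r
    proof
      assume *: "y2 = r *\<^sub>R y1"
      then have "g2 = g1 \<star> (inverse a * of_real r * b)"
        using nz by (simp add: g scale_mult scale_of_real)
      then show False
        using point_eq_iff[OF \<open>g2 \<noteq> 0\<close>, of g1] assms(3) by metis
    qed
    then show "y1 \<noteq> y2" using no[of 1] by auto
    show "independent {y1, y2}"
      using no nz \<open>y1 \<noteq> y2\<close> by (subst insert_commute) (auto simp: independent_insert span_singleton)
  qed
  have "W = span {y1, y2}"
  proof
    have "card {y1, y2} = dim W"
      using W \<open>y1 \<noteq> y2\<close> by (simp add: geodesic_plane_def)
    then show "W \<subseteq> span {y1, y2}"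
      using card_eq_dim[of "{y1, y2}" W] indep y by auto
    show "span {y1, y2} \<subseteq> W"
      using W y by (intro span_minimal) (auto simp: geodesic_plane_def)
  qed
  also have "\<dots> = (\<lambda>x. x \<star> inverse a) ` span {g1, w2}"
  proof (intro equalityI subsetI)
    fix x assume "x \<in> span {y1, y2}"
    then obtain p q where "x = p *\<^sub>R y1 + q *\<^sub>R y2" by (auto simp: mem_span_pair)
    then have "x \<star> a = p *\<^sub>R g1 + (q * \<rho>) *\<^sub>R w2"
      by (simp add: scale_add_left scale_scaleR_left g y2a)
    then have "x \<star> a \<in> span {g1, w2}" by (auto simp: mem_span_pair)
    then show "x \<in> (\<lambda>x. x \<star> inverse a) ` span {g1, w2}"
      using nz by (intro image_eqI[of _ _ "x \<star> a"]) auto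
  next
    fix x assume "x \<in> (\<lambda>x. x \<star> inverse a) ` span {g1, w2}"
    then obtain p q where "x = (p *\<^sub>R g1 + q *\<^sub>R w2) \<star> inverse a" by (auto simp: mem_span_pair)
    moreover have "g1 \<star> inverse a = y1" using nz by (simp add: g)
    moreover have "w2 \<star> inverse a = inverse \<rho> *\<^sub>R y2"
      using nz by (simp add: w2 \<rho>_def scale_scaleR_left)
    ultimately have "x = p *\<^sub>R y1 + (q * inverse \<rho>) *\<^sub>R y2"
      by (simp add: scale_add_left scale_scaleR_left)
    then show "x \<in> span {y1, y2}" by (auto simp: mem_span_pair)
  qed
  finally show ?thesis
    using nz unfolding w2_def by (intro exI[of _ "inverse a"]) auto
qed

text \<open>If the Gram determinant vanished, \<open>g1 - m *\<^sub>R w2\<close> would be a nonzero vector orthogonal to the whole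
  \<open>K\<close>-span, and the geodesic would be euclidean.\<close>

lemma geodesic_through_frame:
  assumes "g1 \<noteq> 0" "g2 \<noteq> 0" "point scale g1 \<noteq> point scale g2" "\<langle>g1, g2\<rangle> \<noteq> 0"
    and noneuclidean: "noneuclidean_geodesic scale form
        (geodesic_through scale form (point scale g1) (point scale g2))"
  defines "w2 \<equiv> g2 \<star> inverse \<langle>g1, g2\<rangle>"
  obtains m n where "geodesic_frame scale form g1 w2 m n"
    "geodesic_through scale form (point scale g1) (point scale g2) = projectivize scale (span {g1, w2})"
    "geodesic_line scale form (projectivize scale (span {g1, w2}))
      = projectivize scale {g1 \<star> a + w2 \<star> b |a b. True}"
proof -
  let ?W = "span {g1, w2}" and ?S = "{g1 \<star> a + w2 \<star> b |a b. True}"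
  obtain m n where mn: "\<langle>g1, g1\<rangle> = of_real m" "\<langle>w2, w2\<rangle> = of_real n"
    using form_self_Reals by (metis Reals_cases)
  have form_12: "\<langle>g1, w2\<rangle> = 1"
    using assms(4) by (simp add: w2_def form_scale_right)
  then have form_21: "\<langle>w2, g1\<rangle> = 1"
    using form_commute[of w2 g1] by simp
  have "point scale w2 = point scale g2"
    using assms(4) by (simp add: w2_def point_scale)
  have "w2 \<noteq> 0" using assms(2,4) by (simp add: w2_def)
  have no: "w2 \<noteq> g1 \<star> k" for k
    using point_eq_iff[OF \<open>w2 \<noteq> 0\<close>, of g1] \<open>point scale w2 = _\<close> assms(3) by metis
  have plane: "geodesic_plane form ?W"
    unfolding geodesic_plane_def
  proof (intro conjI ballI)
    have "w2 \<noteq> r *\<^sub>R g1" for r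
      using no[of "of_real r"] by (simp add: scale_of_real)
    then have "independent {w2, g1}" "w2 \<noteq> g1"
      using no[of 1] assms(1) by (auto simp: independent_insert span_singleton)
    then show "dim ?W = 2"
      by (simp add: dim_eq_card_independent insert_commute)
    fix u v assume "u \<in> ?W" "v \<in> ?W"
    then show "\<langle>u, v\<rangle> \<in> \<real>"
      by (auto simp: mem_span_pair form_add_left form_add_right form_scaleR_left form_scaleR_right
          mn form_12 form_21) (auto simp: scaleR_conv_of_real)
  next
    show "\<exists>u\<in>?W. \<exists>v\<in>?W. \<langle>u, v\<rangle> \<noteq> 0"
      using assms(4) form_12 by (intro bexI[of _ g1] bexI[of _ w2]) (auto intro: span_base)
  qed simp
  have 12: "point scale g1 \<in> projectivize scale ?W" "point scale g2 \<in> projectivize scale ?W"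
    using assms(1) \<open>w2 \<noteq> 0\<close> unfolding \<open>point scale w2 = _\<close>[symmetric]
    by (auto simp: projectivize_def intro!: imageI span_base)
  have unique: "projectivize scale W = projectivize scale ?W \<and> kspan scale W = ?S"
    if "geodesic_plane form W" "point scale g1 \<in> projectivize scale W"
      "point scale g2 \<in> projectivize scale W" for W
    using geodesic_plane_through[OF assms(1-4) that] projectivize_scale kspan_pair
    unfolding w2_def by metis
  have through: "geodesic_through scale form (point scale g1) (point scale g2) = projectivize scale ?W"
    unfolding geodesic_through_def geodesic_def
  proof (rule the_equality)
    show "(\<exists>W. geodesic_plane form W \<and> projectivize scale ?W = projectivize scale W) \<and>
        point scale g1 \<in> projectivize scale ?W \<and> point scale g2 \<in> projectivize scale ?W"
      using plane 12 by blast
    fix G assume "(\<exists>W. geodesic_plane form W \<and> G = projectivize scale W) \<and>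
        point scale g1 \<in> G \<and> point scale g2 \<in> G"
    then show "G = projectivize scale ?W" using unique by blast
  qed
  have line: "geodesic_line scale form (projectivize scale ?W) = projectivize scale ?S"
    unfolding geodesic_line_def
  proof (rule the_equality)
    show "\<exists>W. geodesic_plane form W \<and> projectivize scale ?W = projectivize scale W \<and>
        projectivize scale ?S = projectivize scale (kspan scale W)"
      using plane unique[OF plane 12] by (intro exI[of _ ?W]) simp
    fix L assume "\<exists>W. geodesic_plane form W \<and> projectivize scale ?W = projectivize scale W \<and>
        L = projectivize scale (kspan scale W)"
    then obtain W where "geodesic_plane form W" "projectivize scale ?W = projectivize scale W"
      "L = projectivize scale (kspan scale W)" by blast
    then show "L = projectivize scale ?S" using unique[of W] 12 by simp
  qed
  have "m * n \<noteq> 1"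
  proof
    assume "m * n = 1"
    define u where "u = g1 - m *\<^sub>R w2"
    have kspan: "kspan scale ?W = ?S" using unique plane 12 by blast
    have "\<langle>u, g1 \<star> a + w2 \<star> b\<rangle> = 0" for a b
    proof -
      have u_form: "\<langle>u, x\<rangle> = \<langle>g1, x\<rangle> - m *\<^sub>R \<langle>w2, x\<rangle>" for x
        using form_add_left[of u "m *\<^sub>R w2" x] by (simp add: u_def form_scaleR_left)
      then show ?thesis
        using \<open>m * n = 1\<close> by (simp add: u_form form_add_right form_scale_right mn form_12 form_21
            algebra_simps flip: scaleR_conv_of_real)
    qed
    moreover have "u \<noteq> 0"
    proof
      assume "u = 0"
      then have "g1 = w2 \<star> of_real m"
        by (simp add: u_def scale_of_real)
      moreover from this have "point scale g1 = point scale w2"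
        using point_eq_iff[OF assms(1)] by metis
      ultimately show False using \<open>point scale w2 = _\<close> assms(3) by simp
    qed
    moreover have "u \<in> ?S"
    proof -
      have "u = g1 \<star> 1 + w2 \<star> of_real (- m)"
        by (simp add: u_def scale_of_real del: of_real_minus)
      then show ?thesis by blast
    qed
    ultimately have "degenerate_on form ?S"
      unfolding degenerate_on_def by auto
    moreover have "nonnull_on form ?S"
      unfolding nonnull_on_def
    proof (intro bexI)
      show "\<langle>g1, w2\<rangle> \<noteq> 0" using form_12 by simp
      show "g1 \<in> ?S" "w2 \<in> ?S"
        using scale_1 scale_0_right by (metis (mono_tags, lifting) add.right_neutral add_0 mem_Collect_eq)+
    qed
    ultimately have "euclidean_geodesic scale form (projectivize scale ?W)"
      unfolding euclidean_geodesic_def using plane kspan by metis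
    then show False
      using noneuclidean by (simp add: through noneuclidean_geodesic_def)
  qed
  then have "geodesic_frame scale form g1 w2 m n"
    by unfold_locales (use mn form_12 in auto)
  then show thesis
    using that through line by blast
qed

end

theorem mainTheorem6:
  fixes scale :: "'v::euclidean_space \<Rightarrow> 'k::conj_div_algebra \<Rightarrow> 'v"
    and form :: "'v \<Rightarrow> 'v \<Rightarrow> 'k" ("\<langle>_, _\<rangle>")
    and g1 g2 :: 'v
    and G L :: "'v set set"
  assumes "hermitian_space scale form"
    and "g1 \<noteq> 0" and "g2 \<noteq> 0"
    and "point scale g1 \<noteq> point scale g2"
    and "\<langle>g1, g2\<rangle> \<noteq> 0"
    and "G = geodesic_through scale form (point scale g1) (point scale g2)"
    and "noneuclidean_geodesic scale form G"
    and "L = geodesic_line scale form G"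
  shows "(\<forall>x. x \<noteq> 0 \<and> point scale x \<in> L \<longrightarrow>
            (point scale x \<in> G \<longleftrightarrow>
             \<langle>x, g1\<rangle> * \<langle>g1, g2\<rangle> * \<langle>g2, x\<rangle> - \<langle>x, g2\<rangle> * \<langle>g2, g1\<rangle> * \<langle>g1, x\<rangle> = 0)) \<and>
         (\<forall>g \<phi>. g \<noteq> 0 \<and> point scale g \<in> G \<and> klinear_on scale (point scale g) \<phi> \<and>
            tangent_vector scale g \<phi> \<in> tangent_space scale (point scale g) L \<longrightarrow>
            (tangent_vector scale g \<phi> \<in> tangent_space scale (point scale g) G \<longleftrightarrow>
             \<langle>\<phi> g, g1\<rangle> * \<langle>g1, g2\<rangle> * \<langle>g2, g\<rangle> + \<langle>g, g1\<rangle> * \<langle>g1, g2\<rangle> * \<langle>g2, \<phi> g\<rangle>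
             - \<langle>\<phi> g, g2\<rangle> * \<langle>g2, g1\<rangle> * \<langle>g1, g\<rangle> - \<langle>g, g2\<rangle> * \<langle>g2, g1\<rangle> * \<langle>g1, \<phi> g\<rangle> = 0))"
proof -
  interpret hermitian_space scale form by fact
  define q where "q = \<langle>g1, g2\<rangle>"
  define w2 where "w2 = scale g2 (inverse q)"
  have "q \<noteq> 0" using assms(5) by (simp add: q_def)
  have g2: "g2 = scale w2 q" using \<open>q \<noteq> 0\<close> by (simp add: w2_def)
  obtain m n where frame: "geodesic_frame scale form g1 w2 m n"
    and through: "geodesic_through scale form (point scale g1) (point scale g2)
      = projectivize scale (span {g1, w2})"
    and line: "geodesic_line scale form (projectivize scale (span {g1, w2}))
      = projectivize scale {scale g1 a + scale w2 b |a b. True}"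
    using geodesic_through_frame[OF assms(2-5) assms(7)[unfolded assms(6)]]
    unfolding w2_def q_def by blast
  have G: "G = projectivize scale (span {g1, w2})"
    and L: "L = projectivize scale {scale g1 a + scale w2 b |a b. True}"
    by (simp_all only: assms(6,8) through line)
  interpret geodesic_frame scale form g1 w2 m n by (rule frame)
  have qq: "q * kconj q = (norm q)\<^sup>2 *\<^sub>R 1" by (rule mult_kconj)
  have bracket: "\<langle>x, g1\<rangle> * \<langle>g1, g2\<rangle> * \<langle>g2, y\<rangle> = (norm q)\<^sup>2 *\<^sub>R (\<langle>x, g1\<rangle> * \<langle>w2, y\<rangle>)"
    "\<langle>x, g2\<rangle> * \<langle>g2, g1\<rangle> * \<langle>g1, y\<rangle> = (norm q)\<^sup>2 *\<^sub>R (\<langle>x, w2\<rangle> * \<langle>g1, y\<rangle>)" for x y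
  proof -
    have "\<langle>x, g1\<rangle> * \<langle>g1, g2\<rangle> * \<langle>g2, y\<rangle> = \<langle>x, g1\<rangle> * (q * kconj q) * \<langle>w2, y\<rangle>"
      by (simp add: g2 form_scale_left form_scale_right form_12 mult.assoc)
    then show "\<langle>x, g1\<rangle> * \<langle>g1, g2\<rangle> * \<langle>g2, y\<rangle> = (norm q)\<^sup>2 *\<^sub>R (\<langle>x, g1\<rangle> * \<langle>w2, y\<rangle>)"
      by (simp add: qq)
    have "\<langle>x, g2\<rangle> * \<langle>g2, g1\<rangle> * \<langle>g1, y\<rangle> = \<langle>x, w2\<rangle> * (q * kconj q) * \<langle>g1, y\<rangle>"
      by (simp add: g2 form_scale_left form_scale_right form_21 mult.assoc)
    then show "\<langle>x, g2\<rangle> * \<langle>g2, g1\<rangle> * \<langle>g1, y\<rangle> = (norm q)\<^sup>2 *\<^sub>R (\<langle>x, w2\<rangle> * \<langle>g1, y\<rangle>)"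
      by (simp add: qq)
  qed
  show ?thesis
    unfolding bracket G L scaleR_add_right[symmetric] scaleR_diff_right[symmetric]
    using \<open>q \<noteq> 0\<close> circle_iff tangent_circle_iff by (simp only: scaleR_eq_0_iff) simp
qed

end
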